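(* Let $\tau=k+\theta$ where $k\in\mathbb{N}_0$ and $\theta\in[0,1)$, and let $\mathcal{R}\subset[0,1)\times[0,\infty)$ be the region defined in the context. If $(\theta,c)\in\mathcal{R}$, then the equation $$h'(t)=-\operatorname{sign}(h(t-\tau))+c\cos(2\pi t)$$ admits a symmetric 1:1-periodic solution $h(t)$ with phase $\alpha\in[-\tfrac14,\tfrac14]\pmod 1$ defined by $c\sin(2\pi\alpha)=u(\theta)$ for $\theta\in[0,\tfrac12)$ and by $c\sin(2\pi\alpha)=v(\theta)$ for $\theta\in[\tfrac12,1)$, given by $$h(t)=p(t)+\frac{c}{2\pi}\bigl(\sin(2\pi t)-\sin(2\pi\alpha)\bigr),$$ where, over a period $t\in[\alpha,\alpha+1)$: if $\theta=0$: $\quad p(t)=\begin{cases}-t+\alpha, & t\in[\alpha,\alpha+\tfrac12),\\ -1+t-\alpha, & t\in[\alpha+\tfrac12,\alpha+1);\end{cases}$ if $\theta\in(0,\tfrac12)$: $\quad p(t)=\begin{cases} t-\alpha, & t\in[\alpha,\alpha+\theta),\\ 2\theta-t+\alpha, & t\in[\alpha+\theta,\alpha+\theta+\tfrac12),\\ -1+t-\alpha, & t\in[\alpha+\theta+\tfrac12,\alpha+1);\end{cases}$ if $\theta=\tfrac12$: $\quad p(t)=\begin{cases} t-\alpha, & t\in[\alpha,\alpha+\tfrac12),\\ 1-t+\alpha, & t\in[\alpha+\tfrac12,\alpha+1);\end{cases}$ if $\theta\in(\tfrac12,1)$: $\quad p(t)=\begin{cases} -t+\alpha, & t\in[\alpha,\alpha+\theta-\tfrac12),\\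 1-2\theta+t-\alpha, & t\in[\alpha+\theta-\tfrac12,\alpha+\theta),\\ 1-t+\alpha, & t\in[\alpha+\theta,\alpha+1).\end{cases}$
   Context: Basic notions. $\operatorname{sign}(0)=0$, $\mathbb{N}_0=\{0,1,2,\dots\}$. A solution is a locally absolutely continuous function satisfying the equation for almost every $t$. The set $Z$ of nondegenerate zeros of $h$ consists of all $z$ with $h(z)=0$ for which there is $\delta>0$ with $h(z_-)h(z_+)<0$ for all $z_-\in(z-\delta,z)$, $z_+\in(z,z+\delta)$; $Z^+\subset Z$ is the subset of upward crossings ($h(z_-)<0<h(z_+)$). A 1:1-periodic orbit is a solution on $\mathbb{R}$ of prime period $1$ with finitely many zeros per period and exactly one element of $Z^+$ per period; it is symmetric if $h(t)=-h(t+\tfrac12)$ for all $t$; a phase is any $\alpha\in Z^+$. Functions and constants. $u(\theta)=\pi(2\theta-\tfrac12)$, $v(\theta)=\pi(\tfrac32-2\theta)$. The number $\hat\theta\approx0.4695$ is the solution in $[\tfrac14,\tfrac12]$ of $$u(\hat\theta)\sin\Bigl(\sqrt{u^2(\hat\theta)-1}\Bigr)+\cos(2\pi\hat\theta)\sqrt{u^2(\hat\theta)-1}=\sin(2\pi\hat\theta).$$ For $\theta\in[\hat\theta,\tfrac12]$, $w_-^2=w_-^2(\theta)$ denotes the smallest solution (with $w_-^2\ge\max\{1,u^2(\theta)\}$, so that all square roots are real) of $$w_-^2\sin\Bigl(\sqrt{w_-^2-1}\Bigr)=u(\theta)\Bigl(\sin(2\pi\theta)-\cos(2\pi\theta)\sqrt{w_-^2-1}\Bigr)-\sqrt{w_-^2-u^2(\theta)}\Bigl(\sin(2\pi\theta)\sqrt{w_-^2-1}+\cos(2\pi\theta)\Bigr).$$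 Region $\mathcal{R}$: the set of all $(\theta,c)\in[0,1)\times[0,\infty)$ satisfying: (i) for $\theta=0$ and $\theta=\tfrac12$: $c^2\ge\tfrac{\pi^2}{4}+1$; (ii) for $\theta=\tfrac14$: $c^2>0$; (iii) for $\theta\in(\hat\theta,\tfrac12)$: $c^2\ge w_-^2(\theta)$; (iv) for $\theta\in[\tfrac14,\hat\theta]$: $c^2\ge u^2(\theta)$; (v) for $\theta\in(0,\tfrac14)$: the conditions (iii) and (iv) with $\theta$ replaced by $\tfrac12-\theta\in(\tfrac14,\tfrac12)$, i.e. $c^2\ge w_-^2(\tfrac12-\theta)$ if $\theta\in(0,\tfrac12-\hat\theta)$ and $c^2\ge u^2(\tfrac12-\theta)$ if $\theta\in[\tfrac12-\hat\theta,\tfrac14)$; (vi) for $\theta\in(\tfrac12,1)$: $\displaystyle c^2\ge v^2(\theta)+\left(\frac{\pi/2+v(\theta)\cos(2\pi\theta)}{\sin(2\pi\theta)}\right)^2.$ *)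

theory Defs
  imports "HOL-Analysis.Analysis"
begin

definition abs_continuous_on_Icc :: "real \<Rightarrow> real \<Rightarrow> (real \<Rightarrow> real) \<Rightarrow> bool" where
  "abs_continuous_on_Icc a b f \<longleftrightarrow>
     (\<forall>\<epsilon>>0. \<exists>\<delta>>0. \<forall>(n::nat) (x::nat \<Rightarrow> real) (y::nat \<Rightarrow> real).
        (\<forall>i<n. a \<le> x i \<and> x i \<le> y i \<and> y i \<le> b) \<and>
        (\<forall>i<n. \<forall>j<n. i \<noteq> j \<longrightarrow> {x i<..<y i} \<inter> {x j<..<y j} = {}) \<and>
        (\<Sum>i<n. y i - x i) < \<delta>
        \<longrightarrow> (\<Sum>i<n. \<bar>f (y i) - f (x i)\<bar>) < \<epsilon>)"

definition locally_abs_continuous :: "(real \<Rightarrow> real) \<Rightarrow> bool" where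
  "locally_abs_continuous f \<longleftrightarrow> (\<forall>a b. a \<le> b \<longrightarrow> abs_continuous_on_Icc a b f)"

definition is_solution :: "real \<Rightarrow> real \<Rightarrow> (real \<Rightarrow> real) \<Rightarrow> bool" where
  "is_solution c \<tau> h \<longleftrightarrow> locally_abs_continuous h \<and>
     (AE t in lebesgue.
        (h has_real_derivative (- sgn (h (t - \<tau>)) + c * cos (2 * pi * t))) (at t))"

definition nondeg_zeros :: "(real \<Rightarrow> real) \<Rightarrow> real set" where
  "nondeg_zeros h = {z. h z = 0 \<and>
     (\<exists>\<delta>>0. \<forall>zm\<in>{z - \<delta><..<z}. \<forall>zp\<in>{z<..<z + \<delta>}. h zm * h zp < 0)}"

definition upward_zeros :: "(real \<Rightarrow> real) \<Rightarrow> real set" where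
  "upward_zeros h = {z \<in> nondeg_zeros h.
     \<exists>\<delta>>0. \<forall>zm\<in>{z - \<delta><..<z}. \<forall>zp\<in>{z<..<z + \<delta>}. h zm < 0 \<and> 0 < h zp}"

definition is_period :: "(real \<Rightarrow> real) \<Rightarrow> real \<Rightarrow> bool" where
  "is_period h T \<longleftrightarrow> 0 < T \<and> (\<forall>t. h (t + T) = h t)"

definition prime_period :: "(real \<Rightarrow> real) \<Rightarrow> real \<Rightarrow> bool" where
  "prime_period h T \<longleftrightarrow> is_period h T \<and> (\<forall>S. is_period h S \<longrightarrow> T \<le> S)"

definition periodic_orbit_11 :: "real \<Rightarrow> real \<Rightarrow> (real \<Rightarrow> real) \<Rightarrow> bool" where
  "periodic_orbit_11 c \<tau> h \<longleftrightarrow>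
     is_solution c \<tau> h \<and> prime_period h 1 \<and>
     (\<forall>a. finite {t \<in> {a..<a + 1}. h t = 0}) \<and>
     (\<forall>a. \<exists>!z. z \<in> {a..<a + 1} \<and> z \<in> upward_zeros h)"

definition symmetric_orbit :: "(real \<Rightarrow> real) \<Rightarrow> bool" where
  "symmetric_orbit h \<longleftrightarrow> (\<forall>t. h t = - h (t + 1/2))"

definition u :: "real \<Rightarrow> real" where
  "u \<theta> = pi * (2 * \<theta> - 1/2)"

definition v :: "real \<Rightarrow> real" where
  "v \<theta> = pi * (3/2 - 2 * \<theta>)"

(* HOL's sqrt is total (odd on negative arguments), so the guard 1 <= u^2 expresses that
   the square root is taken of a nonnegative number. *)
definition theta_hat :: real where
  "theta_hat = (THE \<theta>. \<theta> \<in> {1/4..1/2} \<and> 1 \<le> (u \<theta>)\<^sup>2 \<and>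
     u \<theta> * sin (sqrt ((u \<theta>)\<^sup>2 - 1)) + cos (2 * pi * \<theta>) * sqrt ((u \<theta>)\<^sup>2 - 1)
       = sin (2 * pi * \<theta>))"

(* The unknown x is the square w_-^2 itself. *)
definition w_minus_sq :: "real \<Rightarrow> real" where
  "w_minus_sq \<theta> = (LEAST x. max 1 ((u \<theta>)\<^sup>2) \<le> x \<and>
     x * sin (sqrt (x - 1)) =
       u \<theta> * (sin (2 * pi * \<theta>) - cos (2 * pi * \<theta>) * sqrt (x - 1))
       - sqrt (x - (u \<theta>)\<^sup>2) * (sin (2 * pi * \<theta>) * sqrt (x - 1) + cos (2 * pi * \<theta>)))"

definition region :: "(real \<times> real) set" where
  "region = {(\<theta>, c). 0 \<le> \<theta> \<and> \<theta> < 1 \<and> 0 \<le> c \<and>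
     (\<theta> = 0 \<or> \<theta> = 1/2 \<longrightarrow> pi\<^sup>2 / 4 + 1 \<le> c\<^sup>2) \<and>
     (\<theta> = 1/4 \<longrightarrow> 0 < c\<^sup>2) \<and>
     (theta_hat < \<theta> \<and> \<theta> < 1/2 \<longrightarrow> w_minus_sq \<theta> \<le> c\<^sup>2) \<and>
     (1/4 \<le> \<theta> \<and> \<theta> \<le> theta_hat \<longrightarrow> (u \<theta>)\<^sup>2 \<le> c\<^sup>2) \<and>
     (0 < \<theta> \<and> \<theta> < 1/2 - theta_hat \<longrightarrow> w_minus_sq (1/2 - \<theta>) \<le> c\<^sup>2) \<and>
     (1/2 - theta_hat \<le> \<theta> \<and> \<theta> < 1/4 \<longrightarrow> (u (1/2 - \<theta>))\<^sup>2 \<le> c\<^sup>2) \<and>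
     (1/2 < \<theta> \<and> \<theta> < 1 \<longrightarrow>
        (v \<theta>)\<^sup>2 + ((pi / 2 + v \<theta> * cos (2 * pi * \<theta>)) / sin (2 * pi * \<theta>))\<^sup>2 \<le> c\<^sup>2)}"

definition phase_value :: "real \<Rightarrow> real" where
  "phase_value \<theta> = (if \<theta> < 1/2 then u \<theta> else v \<theta>)"

(* Only meaningful for t in [\<alpha>, \<alpha> + 1). *)
definition p_cell :: "real \<Rightarrow> real \<Rightarrow> real \<Rightarrow> real" where
  "p_cell \<theta> \<alpha> t =
     (if \<theta> = 0 then
        (if t < \<alpha> + 1/2 then - t + \<alpha> else - 1 + t - \<alpha>)
      else if \<theta> < 1/2 then
        (if t < \<alpha> + \<theta> then t - \<alpha>
         else if t < \<alpha> + \<theta> + 1/2 then 2 * \<theta> - t + \<alpha>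
         else - 1 + t - \<alpha>)
      else if \<theta> = 1/2 then
        (if t < \<alpha> + 1/2 then t - \<alpha> else 1 - t + \<alpha>)
      else
        (if t < \<alpha> + \<theta> - 1/2 then - t + \<alpha>
         else if t < \<alpha> + \<theta> then 1 - 2 * \<theta> + t - \<alpha>
         else 1 - t + \<alpha>))"

(* 1-periodic extension: t - \<lfloor>t - \<alpha>\<rfloor> is the representative of t modulo 1 in [\<alpha>, \<alpha> + 1). *)
definition p :: "real \<Rightarrow> real \<Rightarrow> real \<Rightarrow> real" where
  "p \<theta> \<alpha> t = p_cell \<theta> \<alpha> (t - of_int \<lfloor>t - \<alpha>\<rfloor>)"

end

theory Submission
  imports Defs "HOL-Complex_Analysis.Conformal_Mappings"
begin

text \<open>
  In all cases the function \<open>p\<close> is a shifted triangular wave, \<open>p t = tri \<theta> - tri (t - \<alpha> - \<theta>)\<close>, where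
  \<open>tri\<close> is the distance to the nearest integer, and the phase equation amounts to
  \<open>h (t + 1/2) = - h t\<close>. Hence everything reduces to \<open>h \<ge> 0\<close> on \<open>[\<alpha>, \<alpha> + 1/2]\<close>: zeros of \<open>h\<close> are
  isolated because each branch of \<open>h\<close> is the restriction of a nonconstant entire function, so then
  the upward zeros are exactly \<open>\<alpha> + \<int>\<close> and the sign of \<open>h (t - \<tau>)\<close> is a square wave almost
  everywhere. On the boundary of the region \<open>h\<close> may have a degenerate zero inside the
  half period, so strict positivity cannot be expected.

  For \<open>\<theta> \<le> 1/2\<close> nonnegativity reads \<open>x - m (1 - cos x) + q sin x \<ge> 0\<close> on \<open>[0, \<pi>]\<close> with \<open>m = \<bar>u \<theta>\<bar>\<close> and
  \<open>q\<^sup>2 = c\<^sup>2 - m\<^sup>2\<close>, a condition monotone in \<open>q\<close> and \<open>m\<close>. With \<open>sin a = m / c\<close>, \<open>r = tan \<phi>\<close> and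
  \<open>c = 1 / cos \<phi>\<close>, the interior local minimum has value \<open>\<pi> + \<phi> - a - r - m\<close>, and the equation for
  \<open>w\<^sub>-\<^sup>2\<close> is \<open>sin r = sin (a + m - \<phi>)\<close>. Besides the tangency, where the minimum vanishes, this
  equation has spurious solutions, but for any solution either the minimum is nonnegative or
  \<open>r \<ge> \<pi>/2\<close>, whence \<open>q \<ge> 1\<close>, which suffices. For \<open>\<theta> > 1/2\<close> the condition on \<open>c\<close> is nonnegativity at
  the corner of \<open>h\<close>, and \<open>h\<close> is first increasing and then concave up to that corner.
\<close>

subsection \<open>The triangular wave and the candidate orbit\<close>

definition tri :: "real \<Rightarrow> real" where
  "tri x = \<bar>x - of_int (round x)\<bar>"

lemma tri_le: "tri x \<le> \<bar>x - of_int n\<bar>"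
  unfolding tri_def by (rule round_diff_minimal)

text \<open>At a half-integer both neighbouring integers are nearest and \<open>round\<close> picks
  one of them. The distance is the same for both, so the bound 1/2 may be attained.\<close>

lemma tri_eq:
  assumes "\<bar>x - of_int n\<bar> \<le> 1/2"
  shows "tri x = \<bar>x - of_int n\<bar>"
proof (rule antisym[OF tri_le], cases "round x = n")
  case False
  then have "1 \<le> \<bar>real_of_int n - of_int (round x)\<bar>"
    by linarith
  then show "\<bar>x - of_int n\<bar> \<le> tri x"
    using assms unfolding tri_def by linarith
qed (simp add: tri_def)

lemma round_half: "\<bar>x - of_int (round x)\<bar> \<le> (1/2 :: real)"
  using of_int_round_abs_le[of x] by (simp add: abs_minus_commute)

lemma tri_add_int: "tri (x + of_int n) = tri x"
  using tri_eq[of "x + of_int n" "round x + n"] round_half[of x]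
  by (simp add: tri_def)

lemma tri_minus: "tri (- x) = tri x"
  using tri_eq[of "- x" "- round x"] round_half[of x]
  by (simp add: tri_def abs_minus_commute)

lemma tri_add_half: "tri (x + 1/2) = 1/2 - tri x"
proof (cases "of_int (round x) \<le> x")
  case True
  then show ?thesis
    using tri_eq[of "x + 1/2" "round x + 1"] round_half[of x] by (simp add: tri_def)
next
  case False
  then show ?thesis
    using tri_eq[of "x + 1/2" "round x"] round_half[of x] by (simp add: tri_def)
qed

lemma tri_lipschitz: "\<bar>tri x - tri y\<bar> \<le> \<bar>x - y\<bar>"
  using tri_le[of x "round y"] tri_le[of y "round x"]
  unfolding tri_def by linarith

lemma tri_has_derivative_up:
  assumes "of_int n < x" "x < of_int n + 1/2"
  shows "(tri has_real_derivative 1) (at x)"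
proof (rule has_field_derivative_transform_within_open)
  show "((\<lambda>y. y - of_int n) has_real_derivative 1) (at x)"
    by (auto intro!: derivative_eq_intros)
  show "open {real_of_int n<..<of_int n + 1/2}" by simp
  show "y - of_int n = tri y" if "y \<in> {real_of_int n<..<of_int n + 1/2}" for y
    using that tri_eq[of y n] by auto
qed (use assms in auto)

lemma tri_has_derivative_down:
  assumes "of_int n - 1/2 < x" "x < of_int n"
  shows "(tri has_real_derivative -1) (at x)"
proof (rule has_field_derivative_transform_within_open)
  show "((\<lambda>y. of_int n - y) has_real_derivative -1) (at x)"
    by (auto intro!: derivative_eq_intros)
  show "open {real_of_int n - 1/2<..<of_int n}" by simp
  show "of_int n - y = tri y" if "y \<in> {real_of_int n - 1/2<..<of_int n}" for y
    using that tri_eq[of y n] by auto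
qed (use assms in auto)

lemma p_eq_tri:
  assumes "0 \<le> \<theta>" "\<theta> < 1"
  shows "p \<theta> \<alpha> t = tri \<theta> - tri (t - \<alpha> - \<theta>)"
proof -
  define s where "s = frac (t - \<alpha>)"
  have s: "0 \<le> s" "s < 1" and t: "t - of_int \<lfloor>t - \<alpha>\<rfloor> = \<alpha> + s"
    unfolding s_def using frac_lt_1[of "t - \<alpha>"] by (auto simp: frac_def)
  have "tri (t - \<alpha> - \<theta>) = tri (s - \<theta> + of_int \<lfloor>t - \<alpha>\<rfloor>)"
    using t by (auto simp: algebra_simps intro!: arg_cong[of _ _ tri])
  then have e: "tri (t - \<alpha> - \<theta>) = tri (s - \<theta>)"
    by (simp only: tri_add_int)
  \<comment> \<open>Since s - \<theta> lies in (-1, 1), its nearest integer is -1, 0 or 1, so these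
    instances of \<open>tri_eq\<close> cover every branch of \<open>p_cell\<close>.\<close>
  have "p_cell \<theta> \<alpha> (\<alpha> + s) = tri \<theta> - tri (s - \<theta>)"
    using s assms tri_eq[of \<theta> 0] tri_eq[of \<theta> 1]
      tri_eq[of "s - \<theta>" 0] tri_eq[of "s - \<theta>" 1] tri_eq[of "s - \<theta>" "-1"]
    unfolding p_cell_def by (auto simp: abs_if split: if_splits)
  then show ?thesis
    by (simp add: p_def t e)
qed

section \<open>The candidate orbit: periodicity, regularity and finiteness of its zeros\<close>

definition orbit :: "real \<Rightarrow> real \<Rightarrow> real \<Rightarrow> real \<Rightarrow> real" where
  "orbit \<theta> c \<alpha> t = tri \<theta> - tri (t - \<alpha> - \<theta>) + c / (2 * pi) * (sin (2 * pi * t) - sin (2 * pi * \<alpha>))"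

lemma sin_2pi_add_int: "sin (2 * pi * (t + of_int n)) = sin (2 * pi * t)"
proof -
  have "2 * pi * (t + of_int n) = 2 * pi * t + 2 * pi * of_int n"
    by (simp add: algebra_simps)
  then show ?thesis
    by (simp only: sin_add cos_int_2pin sin_int_2pin mult_1_right mult_zero_right add_0_right diff_0_right)
qed

lemma orbit_add_int: "orbit \<theta> c \<alpha> (t + of_int n) = orbit \<theta> c \<alpha> t"
  unfolding orbit_def sin_2pi_add_int
  using tri_add_int[of "t - \<alpha> - \<theta>" n] by (simp add: algebra_simps)

text \<open>A phase is prescribed only modulo 1; this identifies the orbits of congruent
  phases.\<close>

lemma orbit_phase_add_int: "orbit \<theta> c (\<alpha> + of_int n) t = orbit \<theta> c \<alpha> t"
  unfolding orbit_def sin_2pi_add_int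
  using tri_add_int[of "t - \<alpha> - \<theta>" "- n"] by (simp add: algebra_simps)

lemma abs_sin_diff_le: "\<bar>sin x - sin y\<bar> \<le> \<bar>x - y :: real\<bar>"
proof -
  have "\<bar>sin x - sin y\<bar> = 2 * (\<bar>sin ((x - y) / 2)\<bar> * \<bar>cos ((x + y) / 2)\<bar>)"
    by (simp add: sin_diff_sin abs_mult)
  also have "\<dots> \<le> 2 * (\<bar>(x - y) / 2\<bar> * 1)"
    by (intro mult_left_mono mult_mono abs_sin_x_le_abs_x abs_cos_le_one) auto
  finally show ?thesis by simp
qed

lemma orbit_lipschitz: "\<bar>orbit \<theta> c \<alpha> x - orbit \<theta> c \<alpha> y\<bar> \<le> (1 + \<bar>c\<bar>) * \<bar>x - y\<bar>"
proof -
  have "\<bar>c / (2 * pi) * (sin (2 * pi * x) - sin (2 * pi * y))\<bar>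
      \<le> \<bar>c\<bar> / (2 * pi) * \<bar>2 * pi * x - 2 * pi * y\<bar>"
    unfolding abs_mult abs_divide
    by (intro mult_mono abs_sin_diff_le) auto
  also have "\<dots> = \<bar>c\<bar> * \<bar>x - y\<bar>"
    by (simp add: abs_mult flip: right_diff_distrib)
  finally have "\<bar>c / (2 * pi) * (sin (2 * pi * x) - sin (2 * pi * y))\<bar> \<le> \<bar>c\<bar> * \<bar>x - y\<bar>" .
  moreover have "\<bar>tri (x - \<alpha> - \<theta>) - tri (y - \<alpha> - \<theta>)\<bar> \<le> \<bar>x - y\<bar>"
    using tri_lipschitz[of "x - \<alpha> - \<theta>" "y - \<alpha> - \<theta>"] by simp
  moreover have "orbit \<theta> c \<alpha> x - orbit \<theta> c \<alpha> y =
      - (tri (x - \<alpha> - \<theta>) - tri (y - \<alpha> - \<theta>)) + c / (2 * pi) * (sin (2 * pi * x) - sin (2 * pi * y))"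
    by (simp add: orbit_def algebra_simps)
  ultimately show ?thesis
    by (simp add: algebra_simps)
qed

lemma lipschitz_imp_locally_abs_continuous:
  assumes "\<And>x y. \<bar>f x - f y\<bar> \<le> L * \<bar>x - y\<bar>"
  shows "locally_abs_continuous f"
  unfolding locally_abs_continuous_def abs_continuous_on_Icc_def
proof (intro allI impI)
  fix a b \<epsilon> :: real
  assume "0 < \<epsilon>"
  \<comment> \<open>The maximum with 1 keeps \<epsilon> / M positive whatever the sign of L.\<close>
  define M where "M = max L 1"
  have f: "\<bar>f x - f y\<bar> \<le> M * \<bar>x - y\<bar>" for x y
    using assms[of x y] mult_right_mono[of L M "\<bar>x - y\<bar>"] unfolding M_def by linarith
  have "(\<Sum>i<n. \<bar>f (y i) - f (x i)\<bar>) < \<epsilon>"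
    if "\<forall>i<n. a \<le> x i \<and> x i \<le> y i \<and> y i \<le> b" "(\<Sum>i<n. y i - x i) < \<epsilon> / M"
    for n :: nat and x y :: "nat \<Rightarrow> real"
  proof -
    have "(\<Sum>i<n. \<bar>f (y i) - f (x i)\<bar>) \<le> (\<Sum>i<n. M * (y i - x i))"
    proof (rule sum_mono)
      fix i assume "i \<in> {..<n}"
      then show "\<bar>f (y i) - f (x i)\<bar> \<le> M * (y i - x i)"
        using f[of "y i" "x i"] that(1) by simp
    qed
    also have "\<dots> = M * (\<Sum>i<n. y i - x i)" by (rule sum_distrib_left[symmetric])
    also have "\<dots> < M * (\<epsilon> / M)"
      using that(2) by (intro mult_strict_left_mono) (simp_all add: M_def)
    finally show ?thesis by (simp add: M_def)
  qed
  moreover have "\<epsilon> / M > 0" using \<open>0 < \<epsilon>\<close> by (simp add: M_def)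
  ultimately show "\<exists>\<delta>>0. \<forall>(n::nat) (x::nat \<Rightarrow> real) (y::nat \<Rightarrow> real).
      (\<forall>i<n. a \<le> x i \<and> x i \<le> y i \<and> y i \<le> b) \<and>
      (\<forall>i<n. \<forall>j<n. i \<noteq> j \<longrightarrow> {x i<..<y i} \<inter> {x j<..<y j} = {}) \<and>
      (\<Sum>i<n. y i - x i) < \<delta> \<longrightarrow> (\<Sum>i<n. \<bar>f (y i) - f (x i)\<bar>) < \<epsilon>"
    by blast
qed

text \<open>The function extends to an entire one whose values at 0 and 1 differ by e, as the sine
  term vanishes at both points. A nonconstant entire function has only finitely many zeros in a
  compact set.\<close>

lemma finite_zeros_linear_plus_sin:
  fixes e d c :: real
  assumes "e \<noteq> 0"
  shows "finite {t \<in> {a..b}. e * t + d + c * sin (2 * pi * t) = 0}"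
proof -
  let ?f = "\<lambda>z::complex. of_real e * z + of_real d + of_real c * sin (2 * of_real pi * z)"
  have f_real: "?f (of_real t) = of_real (e * t + d + c * sin (2 * pi * t))" for t
    by (simp flip: sin_of_real)
  have "finite {w \<in> of_real ` {a..b}. ?f w = 0}"
  proof (rule holomorphic_compact_finite_zeros)
    show "?f holomorphic_on UNIV" by (intro holomorphic_intros)
    show "compact (complex_of_real ` {a..b})"
      by (intro compact_continuous_image continuous_intros compact_Icc)
    show "\<not> ?f constant_on UNIV"
    proof
      assume "?f constant_on UNIV"
      then have "?f (of_real 0) = ?f (of_real 1)"
        unfolding constant_on_def by (metis UNIV_I)
      then show False
        unfolding f_real using assms by simp
    qed
  qed auto
  then have "finite (of_real ` {t \<in> {a..b}. e * t + d + c * sin (2 * pi * t) = 0} :: complex set)"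
    by (rule rev_finite_subset) (auto simp: f_real simp del: of_real_add of_real_mult)
  then show ?thesis
    by (rule finite_imageD) (auto simp: inj_on_def)
qed

text \<open>On a bounded interval only finitely many integers n are nearest to t - \<alpha> -
  \<theta>. For each n and each side of it the orbit is an affine function of slope e = 1 or -1 plus
  a sine term.\<close>

lemma finite_orbit_zeros: "finite {t \<in> {a..b}. orbit \<theta> c \<alpha> t = 0}"
proof -
  define A where "A = {t \<in> {a..b}. orbit \<theta> c \<alpha> t = 0}"
  define C where "C = c / (2 * pi)"
  define N where "N = {\<lfloor>a - \<alpha> - \<theta>\<rfloor> - 1..\<lceil>b - \<alpha> - \<theta>\<rceil> + 1}"
  define D where "D e n = tri \<theta> + e * (- \<alpha> - \<theta> - of_int n) - C * sin (2 * pi * \<alpha>)" for e n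
  have "A \<subseteq> (\<Union>n\<in>N. \<Union>e\<in>{1,-1}. {t \<in> {a..b}. e * t + D e n + C * sin (2 * pi * t) = 0})"
  proof
    fix t assume t: "t \<in> A"
    define n where "n = round (t - \<alpha> - \<theta>)"
    have "\<bar>t - \<alpha> - \<theta> - of_int n\<bar> \<le> 1/2"
      unfolding n_def by (rule round_half)
    moreover have "t \<in> {a..b}" using t by (simp add: A_def)
    ultimately have n: "n \<in> N"
      unfolding N_def atLeastAtMost_iff by linarith
    define e where "e = (if t - \<alpha> - \<theta> - of_int n \<ge> 0 then -1 else 1 :: real)"
    have "tri (t - \<alpha> - \<theta>) = - e * (t - \<alpha> - \<theta> - of_int n)"
      unfolding tri_def e_def n_def by simp
    then have "orbit \<theta> c \<alpha> t = e * t + D e n + C * sin (2 * pi * t)"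
      unfolding orbit_def D_def C_def by (simp add: algebra_simps)
    moreover have "e \<in> {1, -1}" by (simp add: e_def)
    ultimately show "t \<in> (\<Union>n\<in>N. \<Union>e\<in>{1,-1}. {t \<in> {a..b}. e * t + D e n + C * sin (2 * pi * t) = 0})"
      using t n unfolding A_def by force
  qed
  moreover have "finite (\<Union>n\<in>N. \<Union>e\<in>{1,-1}. {t \<in> {a..b}. e * t + D e n + C * sin (2 * pi * t) = 0})"
    by (intro finite_UN_I finite_zeros_linear_plus_sin) (auto simp: N_def)
  ultimately show ?thesis
    unfolding A_def by (rule finite_subset)
qed

subsection \<open>Nonnegativity on a half period\<close>

lemma concave_on_nonneg:
  fixes f :: "real \<Rightarrow> real"
  assumes "concave_on {a..b} f" "0 \<le> f a" "0 \<le> f b" "x \<in> {a..b}"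
  shows "0 \<le> f x"
proof (cases "a = b")
  case True
  then show ?thesis using assms by auto
next
  case False
  define s where "s = (x - a) / (b - a)"
  have s: "0 \<le> s" "s \<le> 1" and x: "(1 - s) *\<^sub>R a + s *\<^sub>R b = x"
  proof -
    have "s * (b - a) = x - a" using False by (simp add: s_def)
    then show "(1 - s) *\<^sub>R a + s *\<^sub>R b = x" by (simp add: algebra_simps)
  qed (use assms(4) False in \<open>auto simp: s_def\<close>)
  have "0 \<le> (1 - s) * f a + s * f b"
    using s assms by simp
  also have "\<dots> \<le> f x"
    using concave_onD[OF assms(1), of s a b] s assms(4) by (simp add: x[simplified])
  finally show ?thesis .
qed

lemma sin_le_tangent:
  fixes \<phi> x :: real
  assumes "0 \<le> \<phi>" "\<phi> < pi" "0 \<le> x" "x \<le> pi"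
  shows "sin x \<le> sin \<phi> + cos \<phi> * (x - \<phi>)"
proof (cases "\<phi> = 0")
  case True
  then show ?thesis using sin_x_le_x[OF assms(3)] by simp
next
  case False
  have "convex_on {0..pi} (\<lambda>x. - sin x)"
    by (rule f''_ge0_imp_convex[where f' = "\<lambda>x. - cos x" and f'' = sin])
       (auto intro!: derivative_eq_intros sin_ge_zero)
  then have "(- sin x) - (- sin \<phi>) \<ge> (- cos \<phi>) * (x - \<phi>)"
    by (rule convex_on_imp_above_tangent)
       (use assms False in \<open>auto intro!: derivative_eq_intros\<close>)
  then show ?thesis by simp
qed

section \<open>The half-period inequality for \<theta> \<le> 1/2\<close>

text \<open>This is 2 pi times the orbit at \<alpha> + s for s \<le> \<theta> \<le> 1/2, with x = 2
  pi s, m = c sin (2 pi \<alpha>) and q = c cos (2 pi \<alpha>).\<close>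

definition excess :: "real \<Rightarrow> real \<Rightarrow> real \<Rightarrow> real" where
  "excess m q x = x - m * (1 - cos x) + q * sin x"

lemma excess_mono:
  assumes "m \<le> m'" "q' \<le> q" "0 \<le> x" "x \<le> pi" "0 \<le> excess m' q' x"
  shows "0 \<le> excess m q x"
proof -
  have "m * (1 - cos x) \<le> m' * (1 - cos x)" "q' * sin x \<le> q * sin x"
    using assms by (auto intro!: mult_right_mono sin_ge_zero)
  then show ?thesis using assms(5) unfolding excess_def by linarith
qed

text \<open>In polar form the function is x - c sin a + c sin (a + x). It is concave up to x = pi -
  a, so there the two endpoints suffice. Beyond, its critical point is x = pi + \<phi> - a, and the
  hypothesis \<open>min\<close> is the value at that point.\<close>

lemma excess_nonneg:
  fixes c a \<phi> :: real
  assumes a: "0 \<le> a" "a \<le> pi/2" and \<phi>: "0 \<le> \<phi>" "\<phi> \<le> pi/2" and c: "c * cos \<phi> = 1"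
    and m: "c * sin a \<le> pi/2"
    and min: "0 \<le> pi + \<phi> - a - c * sin \<phi> - c * sin a"
    and x: "0 \<le> x" "x \<le> pi"
  shows "0 \<le> excess (c * sin a) (c * cos a) x"
proof -
  have c0: "0 < c"
    using c \<phi> cos_ge_zero[of \<phi>] zero_less_mult_iff[of c "cos \<phi>"] by simp
  have eq: "excess (c * sin a) (c * cos a) x = x - c * sin a + c * sin (a + x)" for x
    by (simp add: excess_def sin_add algebra_simps)
  show ?thesis
  proof (cases "x \<le> pi - a")
    case True
    have "concave_on {0..pi - a} (\<lambda>x. x - c * sin a + c * sin (a + x))"
    proof (rule f''_le0_imp_concave)
      show "((\<lambda>x. x - c * sin a + c * sin (a + x)) has_real_derivative 1 + c * cos (a + x)) (at x)" for x
        by (auto intro!: derivative_eq_intros)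
      show "((\<lambda>x. 1 + c * cos (a + x)) has_real_derivative - c * sin (a + x)) (at x)" for x
        by (auto intro!: derivative_eq_intros)
      show "- c * sin (a + x) \<le> 0" if "x \<in> {0..pi - a}" for x
        using that a c0 by (auto intro!: mult_nonneg_nonneg sin_ge_zero)
    qed simp
    then show ?thesis
      unfolding eq by (rule concave_on_nonneg) (use True x a m in auto)
  next
    case False
    \<comment> \<open>The tangent at \<phi> has slope cos \<phi> = 1 / c, so after multiplication by
      c the dependence on x cancels and only the minimum value remains.\<close>
    have "sin (a + x - pi) \<le> sin \<phi> + cos \<phi> * (a + x - pi - \<phi>)"
      by (rule sin_le_tangent) (use a x \<phi> False in auto)
    then have "c * sin (a + x - pi) \<le> c * (sin \<phi> + cos \<phi> * (a + x - pi - \<phi>))"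
      using c0 by (intro mult_left_mono) auto
    also have "\<dots> = c * sin \<phi> + c * cos \<phi> * (a + x - pi - \<phi>)"
      by (simp add: algebra_simps)
    finally have "c * sin (a + x - pi) \<le> c * sin \<phi> + c * cos \<phi> * (a + x - pi - \<phi>)" .
    moreover have "sin (a + x - pi) = - sin (a + x)"
      by (simp add: sin_diff)
    ultimately show ?thesis
      unfolding eq using min c by simp
  qed
qed

text \<open>By monotonicity only m = pi/2, q = 1 has to be treated. There a = \<phi>, and the
  minimum value is pi - pi/2 - pi/2 = 0, taken at x = pi.\<close>

lemma excess_nonneg_of_ge_1:
  assumes "m \<le> pi/2" "1 \<le> q" "0 \<le> x" "x \<le> pi"
  shows "0 \<le> excess m q x"
proof -
  define c where "c = sqrt (1 + (pi/2)\<^sup>2)"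
  define \<phi> where "\<phi> = arctan (pi/2)"
  have c0: "0 < c" unfolding c_def by (intro real_sqrt_gt_zero add_pos_nonneg) auto
  have \<phi>: "0 \<le> \<phi>" "\<phi> \<le> pi/2"
    using arctan_ubound[of "pi/2"] by (auto simp: \<phi>_def)
  have s: "c * sin \<phi> = pi/2" "c * cos \<phi> = 1"
    using c0 by (simp_all add: \<phi>_def sin_arctan cos_arctan flip: c_def)
  have "0 \<le> excess (c * sin \<phi>) (c * cos \<phi>) x"
    by (rule excess_nonneg[where \<phi> = \<phi>]) (use \<phi> s assms in auto)
  then show ?thesis
    unfolding s using assms by (intro excess_mono[of m "pi/2" 1 q x]) auto
qed

section \<open>Polar coordinates and the equation for the squared amplitude\<close>

text \<open>Here x stands for the squared amplitude. The angle a belongs to the pair (q, m) with q^2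
  = x - m^2, the angle \<phi> to the pair (1, r) with r^2 = x - 1; both pairs have length c.\<close>

lemma polar:
  fixes m x :: real
  assumes "0 \<le> m" "max 1 (m\<^sup>2) \<le> x"
  defines "c \<equiv> sqrt x" and "a \<equiv> arcsin (m / sqrt x)" and "\<phi> \<equiv> arctan (sqrt (x - 1))"
  shows "c * sin a = m" "c * cos a = sqrt (x - m\<^sup>2)" "c * sin \<phi> = sqrt (x - 1)" "c * cos \<phi> = 1"
    and "0 \<le> a" "a \<le> pi/2" "0 \<le> \<phi>" "\<phi> \<le> pi/2" "1 \<le> c"
proof -
  have x: "1 \<le> x" "m\<^sup>2 \<le> x" using assms(2) by auto
  have c: "1 \<le> c" "c\<^sup>2 = x" using x by (auto simp: c_def)
  have mc: "0 \<le> m / c" "m / c \<le> 1"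
    using c assms(1) real_le_rsqrt[OF x(2)] by (auto simp: c_def)
  show "c * sin a = m"
    using mc c(1) by (simp add: a_def flip: c_def)
  have "c * cos a = sqrt (c\<^sup>2 * (1 - (m / c)\<^sup>2))"
    using mc c by (simp add: a_def cos_arcsin real_sqrt_mult flip: c_def)
  also have "c\<^sup>2 * (1 - (m / c)\<^sup>2) = x - m\<^sup>2"
    using c x(1) by (simp add: power_divide right_diff_distrib)
  finally show "c * cos a = sqrt (x - m\<^sup>2)" .
  have "sqrt (1 + (sqrt (x - 1))\<^sup>2) = c" using x by (simp add: c_def)
  then show "c * sin \<phi> = sqrt (x - 1)" "c * cos \<phi> = 1"
    using c by (simp_all add: \<phi>_def sin_arctan cos_arctan)
  show "0 \<le> a" "a \<le> pi/2"
    using mc arcsin_bounded[of "m / c"] arcsin_le_arcsin[of 0 "m / c"] by (auto simp: a_def simp flip: c_def)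
  show "0 \<le> \<phi>" "\<phi> \<le> pi/2"
    using x arctan_ubound[of "sqrt (x - 1)"] by (auto simp: \<phi>_def)
  show "1 \<le> c" by fact
qed

text \<open>The defining equation of \<open>w_minus_sq\<close> after 2 pi \<theta> = m + pi/2, which
  turns sin (2 pi \<theta>) into cos m and cos (2 pi \<theta>) into - sin m.\<close>

definition w_eq :: "real \<Rightarrow> real \<Rightarrow> bool" where
  "w_eq m x \<longleftrightarrow> x * sin (sqrt (x - 1)) =
     m * (cos m + sin m * sqrt (x - 1)) - sqrt (x - m\<^sup>2) * (cos m * sqrt (x - 1) - sin m)"

lemma w_eq_iff:
  fixes m x :: real
  assumes "0 \<le> m" "max 1 (m\<^sup>2) \<le> x"
  shows "w_eq m x \<longleftrightarrow> sin (sqrt (x - 1)) = sin (arcsin (m / sqrt x) + m - arctan (sqrt (x - 1)))"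
proof -
  define c where "c = sqrt x"
  define a where "a = arcsin (m / sqrt x)"
  define \<phi> where "\<phi> = arctan (sqrt (x - 1))"
  note P = polar[OF assms, folded a_def \<phi>_def, folded c_def]
  have x: "x = c * c" "x \<noteq> 0" using assms by (auto simp: c_def)
  have "m * (cos m + sin m * sqrt (x - 1)) - sqrt (x - m\<^sup>2) * (cos m * sqrt (x - 1) - sin m)
      = (c * sin a) * ((c * cos \<phi>) * cos m + sin m * (c * sin \<phi>))
        - (c * cos a) * (cos m * (c * sin \<phi>) - (c * cos \<phi>) * sin m)"
    unfolding P by simp
  also have "\<dots> = x * sin (a + (m - \<phi>))"
    unfolding x sin_add cos_diff sin_diff by (simp add: algebra_simps)
  finally show ?thesis
    using x(2) unfolding w_eq_def a_def[symmetric] \<phi>_def[symmetric] by (simp add: add_diff_eq)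
qed

text \<open>With c = sqrt z the fourth hypothesis is the minimum condition of
  \<open>excess_nonneg\<close>, because c sin \<phi> = sqrt (z - 1) and c sin a = m.\<close>

lemma excess_nonneg_of_min_nonneg:
  assumes "0 \<le> m" "m \<le> pi/2" "max 1 (m\<^sup>2) \<le> z"
    and "arcsin (m / sqrt z) + m - arctan (sqrt (z - 1)) \<le> pi - sqrt (z - 1)"
    and "0 \<le> x" "x \<le> pi"
  shows "0 \<le> excess m (sqrt (z - m\<^sup>2)) x"
proof -
  define c where "c = sqrt z"
  define a where "a = arcsin (m / sqrt z)"
  define \<phi> where "\<phi> = arctan (sqrt (z - 1))"
  note P = polar[OF assms(1,3), folded a_def \<phi>_def, folded c_def]
  have "0 \<le> excess (c * sin a) (c * cos a) x"
    by (rule excess_nonneg[where \<phi> = \<phi>]) (use P assms(2,4-6) a_def \<phi>_def in linarith)+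
  then show ?thesis unfolding P .
qed

lemma excess_nonneg_of_w_eq:
  assumes "0 \<le> m" "m \<le> pi/2" "max 1 (m\<^sup>2) \<le> z" "w_eq m z" "0 \<le> x" "x \<le> pi"
  shows "0 \<le> excess m (sqrt (z - m\<^sup>2)) x"
\<comment> \<open>If r = sqrt (z - 1) is at least pi/2, then z - 1 \<ge> m^2, so q \<ge> 1 and the
  minimum condition is bypassed.\<close>
proof (cases "pi/2 \<le> sqrt (z - 1)")
  case True
  have "(pi/2)\<^sup>2 \<le> z - 1"
    using power_mono[OF True, of 2] assms(3) by simp
  moreover have "m\<^sup>2 \<le> (pi/2)\<^sup>2"
    using assms by (intro power_mono)
  ultimately have "1 \<le> sqrt (z - m\<^sup>2)" by simp
  then show ?thesis using assms by (intro excess_nonneg_of_ge_1)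
next
  case False
  define \<psi> where "\<psi> = arcsin (m / sqrt z) + m - arctan (sqrt (z - 1))"
  have \<psi>: "\<psi> \<le> pi" "sin \<psi> = sin (sqrt (z - 1))"
    using polar(6,7)[OF assms(1,3)] assms(2,4) w_eq_iff[OF assms(1,3)]
    unfolding \<psi>_def by linarith+
  have "\<psi> \<le> pi - sqrt (z - 1)"
  \<comment> \<open>Otherwise 0 \<le> pi - \<psi> < r < pi/2, where the sine is strictly increasing,
    against sin \<psi> = sin r.\<close>
  proof (rule ccontr)
    assume *: "\<not> ?thesis"
    have "sin (pi - \<psi>) < sin (sqrt (z - 1))"
      using * False \<psi>(1) by (intro sin_monotone_2pi) auto
    then show False using \<psi>(2) by simp
  qed
  then show ?thesis
    using assms by (intro excess_nonneg_of_min_nonneg) (auto simp: \<psi>_def)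
qed

lemma trig_2pi_eq_u:
  "sin (2 * pi * \<theta>) = cos (u \<theta>)" "cos (2 * pi * \<theta>) = - sin (u \<theta>)"
proof -
  have "2 * pi * \<theta> = u \<theta> + pi/2" by (simp add: u_def algebra_simps)
  then show "sin (2 * pi * \<theta>) = cos (u \<theta>)" "cos (2 * pi * \<theta>) = - sin (u \<theta>)"
    by (simp_all add: sin_add cos_add)
qed

lemma w_minus_sq_eq: "w_minus_sq \<theta> = (LEAST x. max 1 ((u \<theta>)\<^sup>2) \<le> x \<and> w_eq (u \<theta>) x)"
  unfolding w_minus_sq_def w_eq_def trig_2pi_eq_u by (simp add: algebra_simps)

section \<open>The threshold \<open>theta_hat\<close> and the least root
  \<open>w_minus_sq\<close>\<close>

text \<open>For the smallest amplitude c = m one has q = 0 and a = pi/2, and the interior minimum of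
  \<open>excess\<close> equals pi/2 - \<open>tangency m\<close>.\<close>

definition tangency :: "real \<Rightarrow> real" where
  "tangency m = m + sqrt (m\<^sup>2 - 1) - arctan (sqrt (m\<^sup>2 - 1))"

lemma arctan_diff_le:
  fixes x y :: real
  assumes "x \<le> y"
  shows "arctan y - arctan x \<le> y - x"
proof -
  have "x - arctan x \<le> y - arctan y"
  proof (rule DERIV_nonneg_imp_nondecreasing[OF assms])
    fix z :: real
    have "((\<lambda>x. x - arctan x) has_real_derivative 1 - inverse (1 + z\<^sup>2)) (at z)"
      by (auto intro!: derivative_eq_intros)
    moreover have "inverse (1 + z\<^sup>2) \<le> 1" by (simp add: inverse_le_1_iff)
    ultimately show "\<exists>d. ((\<lambda>x. x - arctan x) has_real_derivative d) (at z) \<and> 0 \<le> d"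
      by auto
  qed
  then show ?thesis by simp
qed

text \<open>The map r - arctan r is nondecreasing and r grows with m; strictness comes from the
  summand m.\<close>

lemma tangency_less:
  assumes "1 \<le> m" "m < m'"
  shows "tangency m < tangency m'"
proof -
  have "sqrt (m\<^sup>2 - 1) \<le> sqrt (m'\<^sup>2 - 1)"
    using assms by (simp add: power_mono)
  from arctan_diff_le[OF this] show ?thesis
    using assms(2) unfolding tangency_def by simp
qed

text \<open>With 1 = m cos \<phi> and r = m sin \<phi> the equation becomes sin r = sin (pi/2 - (m -
  \<phi>)). By 0 \<le> \<phi> \<le> r \<le> m \<le> pi/2 both arguments lie in [-pi/2, pi/2], where
  the sine is injective.\<close>

lemma theta_hat_equation_iff:
  assumes "1 \<le> m" "m \<le> pi/2"
  shows "m * sin (sqrt (m\<^sup>2 - 1)) - sin m * sqrt (m\<^sup>2 - 1) = cos m \<longleftrightarrow> tangency m = pi/2"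
proof -
  define r where "r = sqrt (m\<^sup>2 - 1)"
  define \<phi> where "\<phi> = arctan r"
  have "0 \<le> m" "max 1 (m\<^sup>2) \<le> m\<^sup>2" using assms by auto
  note P = polar[OF this, folded r_def, folded \<phi>_def]
  have r: "m * sin \<phi> = r" "m * cos \<phi> = 1"
    using P(3,4) assms(1) by simp_all
  have "r \<le> sqrt (m\<^sup>2)" unfolding r_def by (rule real_sqrt_le_mono) simp
  then have bounds: "0 \<le> r" "r \<le> m" "0 \<le> \<phi>" "\<phi> \<le> r"
    using assms(1) P(7) by (auto simp: r_def \<phi>_def arctan_le_self)
  have "m * sin r - sin m * r = cos m \<longleftrightarrow> m * sin r = (m * cos \<phi>) * cos m + sin m * (m * sin \<phi>)"
    unfolding r by auto
  also have "(m * cos \<phi>) * cos m + sin m * (m * sin \<phi>) = m * cos (m - \<phi>)"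
    by (simp add: cos_diff algebra_simps)
  also have "m * sin r = m * cos (m - \<phi>) \<longleftrightarrow> sin r = sin (pi/2 - (m - \<phi>))"
    using assms(1) by (simp add: cos_sin_eq)
  also have "\<dots> \<longleftrightarrow> r = pi/2 - (m - \<phi>)"
  proof
    assume "sin r = sin (pi/2 - (m - \<phi>))"
    then show "r = pi/2 - (m - \<phi>)"
      by (rule sin_inj_pi[rotated 4]) (use bounds assms in linarith)+
  qed simp
  finally show ?thesis
    unfolding tangency_def r_def[symmetric] \<phi>_def[symmetric] by auto
qed

text \<open>The definite description is justified by the intermediate value theorem for
  \<open>tangency\<close> on [1, pi/2] (existence) and by strict monotonicity (uniqueness).\<close>

lemma theta_hat_properties:
  shows "theta_hat \<in> {1/4..1/2}" "1 \<le> u theta_hat" "tangency (u theta_hat) = pi/2"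
proof -
  define P where "P \<theta> \<longleftrightarrow> \<theta> \<in> {1/4..1/2} \<and> 1 \<le> (u \<theta>)\<^sup>2 \<and>
     u \<theta> * sin (sqrt ((u \<theta>)\<^sup>2 - 1)) + cos (2 * pi * \<theta>) * sqrt ((u \<theta>)\<^sup>2 - 1)
       = sin (2 * pi * \<theta>)" for \<theta>
  have P_iff: "P \<theta> \<longleftrightarrow> \<theta> \<in> {1/4..1/2} \<and> 1 \<le> u \<theta> \<and> tangency (u \<theta>) = pi/2" for \<theta>
  proof (cases "\<theta> \<in> {1/4..1/2}")
    case True
    then have "0 \<le> u \<theta>" "pi * (2 * \<theta> - 1/2) \<le> pi * (1/2)"
      by (auto simp: u_def intro!: mult_left_mono)
    moreover have "1 \<le> (u \<theta>)\<^sup>2 \<longleftrightarrow> 1 \<le> u \<theta>"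
      using \<open>0 \<le> u \<theta>\<close> power2_le_iff_abs_le[of 1] by (simp add: one_le_power power2_nonneg_ge_1_iff)
    ultimately show ?thesis
      using theta_hat_equation_iff[of "u \<theta>"] True
      unfolding P_def trig_2pi_eq_u by (auto simp: u_def)
  qed (auto simp: P_def)
  have "\<exists>m\<ge>1. m \<le> pi/2 \<and> tangency m = pi/2"
  proof (rule IVT')
    show "tangency 1 \<le> pi/2"
      using pi_gt3 by (simp add: tangency_def)
    show "pi/2 \<le> tangency (pi/2)"
      using arctan_le_self[of "sqrt ((pi/2)\<^sup>2 - 1)"] pi_gt3
        power_mono[of 1 "pi/2" 2]
      by (simp add: tangency_def)
    show "continuous_on {1..pi/2} tangency"
      unfolding tangency_def by (intro continuous_intros)
  qed (use pi_gt3 in simp)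
  then obtain m where m: "1 \<le> m" "m \<le> pi/2" "tangency m = pi/2" by blast
  \<comment> \<open>The affine map \<open>u\<close> is inverted here to turn the root m into an
    angle.\<close>
  have "u (m / (2 * pi) + 1/4) = m"
    by (simp add: u_def algebra_simps)
  then have ex: "P (m / (2 * pi) + 1/4)"
    using m by (simp add: P_iff field_simps)
  have uniq: "\<theta> = \<theta>'" if "P \<theta>" "P \<theta>'" for \<theta> \<theta>'
  proof -
    have "u \<theta> = u \<theta>'"
      using that tangency_less[of "u \<theta>" "u \<theta>'"] tangency_less[of "u \<theta>'" "u \<theta>"]
      unfolding P_iff by (cases "u \<theta>" "u \<theta>'" rule: linorder_cases) auto
    then show ?thesis by (simp add: u_def)
  qed
  have "\<exists>!\<theta>. P \<theta>"
    using ex uniq[OF _ ex] by (rule ex1I)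
  then have "P (THE \<theta>. P \<theta>)"
    by (rule theI')
  moreover have "theta_hat = (THE \<theta>. P \<theta>)"
    unfolding theta_hat_def P_def ..
  ultimately have "P theta_hat" by (simp only:)
  then show "theta_hat \<in> {1/4..1/2}" "1 \<le> u theta_hat" "tangency (u theta_hat) = pi/2"
    by (auto simp: P_iff)
qed

text \<open>A root of F = pi is a tangency and hence solves the equation, as sin (pi - r) = sin r.
  At x = m^2 one has F = pi/2 + \<open>tangency m\<close>, which is at least pi; at z, chosen so
  that r = pi/2, one has a \<le> \<phi> and m \<le> pi/2, so F \<le> pi.\<close>

lemma w_eq_solvable:
  assumes "1 \<le> m" "m \<le> pi/2" "pi/2 \<le> tangency m"
  shows "\<exists>x. max 1 (m\<^sup>2) \<le> x \<and> w_eq m x"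
proof -
  define F where "F x = arcsin (m / sqrt x) + m - arctan (sqrt (x - 1)) + sqrt (x - 1)" for x
  define z where "z = 1 + (pi/2)\<^sup>2"
  have m2: "1 \<le> m\<^sup>2" "m\<^sup>2 \<le> (pi/2)\<^sup>2"
    using assms(1,2) by (auto intro!: power_mono)
  have m0: "0 \<le> m" and z: "max 1 (m\<^sup>2) \<le> z"
    using assms(1) add_mono[OF zero_le_one m2(2)] by (simp_all add: z_def)
  have "\<exists>x\<ge>m\<^sup>2. x \<le> z \<and> F x = pi"
  proof (rule IVT2')
    show "pi \<le> F (m\<^sup>2)"
      using assms by (simp add: F_def tangency_def)
    have "sin (arcsin (m / sqrt z)) \<le> sin (arctan (sqrt (z - 1)))"
    proof -
      have "sqrt z * sin (arcsin (m / sqrt z)) \<le> sqrt z * sin (arctan (sqrt (z - 1)))"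
        unfolding polar[OF m0 z] using assms(2) by (simp add: z_def)
      then show ?thesis
        using polar(9)[OF m0 z] by (subst (asm) mult_le_cancel_left_pos) auto
    qed
    then have "arcsin (m / sqrt z) \<le> arctan (sqrt (z - 1))"
      by (subst (asm) sin_mono_le_eq) (use polar(5-8)[OF m0 z] pi_gt_zero in linarith)+
    moreover have "sqrt (z - 1) = pi/2" by (simp add: z_def)
    ultimately show "F z \<le> pi"
      using assms(2) unfolding F_def by linarith
    have x: "0 < x \<and> 0 \<le> m / sqrt x \<and> m / sqrt x \<le> 1" if "m\<^sup>2 \<le> x" for x
      using m0 m2(1) that real_le_rsqrt[OF that] by auto
    have "- 1 \<le> m / sqrt x" if "m\<^sup>2 \<le> x" for x
      using x[OF that] by linarith
    with x show "continuous_on {m\<^sup>2..z} F"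
      unfolding F_def by (intro continuous_intros) force+
  qed (use z in simp)
  then obtain x where x: "m\<^sup>2 \<le> x" "F x = pi" by blast
  then have x1: "max 1 (m\<^sup>2) \<le> x" using m2 by simp
  have "arcsin (m / sqrt x) + m - arctan (sqrt (x - 1)) = pi - sqrt (x - 1)"
    using x(2) unfolding F_def by simp
  then have "w_eq m x"
    unfolding w_eq_iff[OF m0 x1] by simp
  with x1 show ?thesis by blast
qed

text \<open>A \<open>LEAST\<close> over the reals is meaningful only if the infimum is attained: the
  solution set is nonempty because \<theta> lies above the threshold, closed by continuity, and
  bounded below by 1.\<close>

lemma w_minus_sq_solution:
  assumes "theta_hat < \<theta>" "\<theta> < 1/2"
  shows "max 1 ((u \<theta>)\<^sup>2) \<le> w_minus_sq \<theta>" "w_eq (u \<theta>) (w_minus_sq \<theta>)"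
proof -
  define S where "S = {x. max 1 ((u \<theta>)\<^sup>2) \<le> x \<and> w_eq (u \<theta>) x}"
  have lt: "u theta_hat < u \<theta>" "u \<theta> \<le> pi/2"
    using assms pi_gt_zero by (auto simp: u_def algebra_simps)
  have "pi/2 \<le> tangency (u \<theta>)"
    using tangency_less[OF theta_hat_properties(2) lt(1)] theta_hat_properties(3) by simp
  then have "S \<noteq> {}"
    using w_eq_solvable[of "u \<theta>"] lt theta_hat_properties(2) by (auto simp: S_def)
  moreover have "closed S"
    unfolding S_def w_eq_def
    by (intro closed_Collect_conj closed_Collect_le closed_Collect_eq continuous_intros)
  moreover have "bdd_below S"
    by (rule bdd_belowI[of _ 1]) (simp add: S_def)
  ultimately have "Inf S \<in> S" "\<And>x. x \<in> S \<Longrightarrow> Inf S \<le> x"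
    by (auto intro: closed_contains_Inf cInf_lower)
  moreover from this have "w_minus_sq \<theta> = Inf S"
    unfolding w_minus_sq_eq by (intro Least_equality) (auto simp: S_def)
  ultimately show "max 1 ((u \<theta>)\<^sup>2) \<le> w_minus_sq \<theta>" "w_eq (u \<theta>) (w_minus_sq \<theta>)"
    by (auto simp: S_def)
qed

text \<open>Both cases compare with an extremal pair by \<open>excess_mono\<close>. Up to
  \<open>theta_hat\<close> the pair is m = \<open>u theta_hat\<close>, q = 0, whose interior minimum
  is exactly 0; above it, m is kept and c^2 is lowered to
  \<open>w_minus_sq \<theta>\<close>.\<close>

lemma excess_nonneg_upper:
  assumes "1/4 \<le> \<theta>" "\<theta> < 1/2"
    and low: "\<theta> \<le> theta_hat \<Longrightarrow> (u \<theta>)\<^sup>2 \<le> c\<^sup>2"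
    and high: "theta_hat < \<theta> \<Longrightarrow> w_minus_sq \<theta> \<le> c\<^sup>2"
  shows "(u \<theta>)\<^sup>2 \<le> c\<^sup>2"
    and "0 \<le> x \<Longrightarrow> x \<le> pi \<Longrightarrow> 0 \<le> excess (u \<theta>) (sqrt (c\<^sup>2 - (u \<theta>)\<^sup>2)) x"
proof -
  have u0: "0 \<le> u \<theta>" "u \<theta> \<le> pi/2"
    using assms(1,2) pi_gt_zero by (auto simp: u_def algebra_simps)
  show le: "(u \<theta>)\<^sup>2 \<le> c\<^sup>2"
    using low high w_minus_sq_solution(1)[of \<theta>] assms(2) by (cases "\<theta> \<le> theta_hat") auto
  assume x: "0 \<le> x" "x \<le> pi"
  show "0 \<le> excess (u \<theta>) (sqrt (c\<^sup>2 - (u \<theta>)\<^sup>2)) x"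
  proof (cases "\<theta> \<le> theta_hat")
    case True
    define m where "m = u theta_hat"
    have m: "1 \<le> m" "m \<le> pi/2" "tangency m = pi/2" "u \<theta> \<le> m"
      using theta_hat_properties True pi_gt_zero by (auto simp: m_def u_def algebra_simps)
    have "0 \<le> excess m (sqrt (m\<^sup>2 - m\<^sup>2)) x"
      by (rule excess_nonneg_of_min_nonneg) (use m x in \<open>auto simp: tangency_def\<close>)
    then show ?thesis
      using m(4) le x by (intro excess_mono[of "u \<theta>" m 0]) auto
  next
    case False
    then have "theta_hat < \<theta>" by simp
    note w = w_minus_sq_solution[OF this assms(2)] high[OF this]
    have "0 \<le> excess (u \<theta>) (sqrt (w_minus_sq \<theta> - (u \<theta>)\<^sup>2)) x"
      using u0 w x by (intro excess_nonneg_of_w_eq) auto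
    moreover have "sqrt (w_minus_sq \<theta> - (u \<theta>)\<^sup>2) \<le> sqrt (c\<^sup>2 - (u \<theta>)\<^sup>2)"
      using w(3) by simp
    ultimately show ?thesis
      using x excess_mono by blast
  qed
qed

section \<open>The half-period inequality for \<theta> > 1/2\<close>

text \<open>The difference K of the two sides is 2 pi times the orbit before its corner s = \<theta>
  - 1/2, that is x = pi/2 - m, and the hypothesis on q says that K is nonnegative at this corner. K
  first increases from K 0 = 0 and is then concave up to the corner.\<close>

lemma deficit_nonneg:
  assumes m: "\<bar>m\<bar> < pi/2" and q: "pi/2 - m * sin m \<le> q * cos m"
    and x: "0 \<le> x" "x \<le> pi/2 - m"
  shows "x \<le> q * sin x - m * (1 - cos x)"
proof -
  define K where "K x = q * sin x - m * (1 - cos x) - x" for x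
  have cos_m: "0 < cos m" using m by (intro cos_gt_zero_pi) auto
  \<comment> \<open>The chain cos m \<le> pi/2 - \<bar>m\<bar> \<le> pi/2 - m sin m \<le> q cos m
    gives q \<ge> 1, so K does not start downwards.\<close>
  have "cos m = sin (pi/2 - \<bar>m\<bar>)" by (simp add: sin_diff)
  also have "\<dots> \<le> pi/2 - \<bar>m\<bar>" using m by (intro sin_x_le_x) auto
  also have "\<dots> \<le> q * cos m"
  proof -
    have "\<bar>m * sin m\<bar> \<le> \<bar>m\<bar> * 1"
      unfolding abs_mult by (intro mult_left_mono) auto
    then show ?thesis using q by linarith
  qed
  finally have q1: "1 \<le> q" using cos_m by (metis mult_le_cancel_right1 not_less_iff_gr_or_eq)
  \<comment> \<open>K' + 1 = q cos y - m sin y is a single cosine of amplitude R centred at x0. For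
    m > 0 this centre is negative and the increasing stretch is empty, hence \<open>max 0 x0\<close>
    below.\<close>
  define x0 where "x0 = arctan (- m / q)"
  define R where "R = q / cos x0"
  have cos_x0: "0 < cos x0"
    using arctan_bounded[of "- m / q"] unfolding x0_def by (intro cos_gt_zero_pi) auto
  have "R * sin x0 = q * tan x0" by (simp add: R_def tan_def)
  then have R: "R * cos x0 = q" "R * sin x0 = - m" "0 < R"
    using q1 cos_x0 by (simp_all add: R_def x0_def tan_arctan)
  have x0: "- pi/2 < x0" "x0 < pi/2" "0 \<le> m \<Longrightarrow> x0 \<le> 0" "m \<le> 0 \<Longrightarrow> 0 \<le> x0"
    using arctan_bounded[of "- m / q"] q1 by (auto simp: x0_def field_simps)
  have K': "(K has_real_derivative R * cos (y - x0) - 1) (at y)" for y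
  proof -
    have "(K has_real_derivative q * cos y - m * sin y - 1) (at y)"
      unfolding K_def by (auto intro!: derivative_eq_intros)
    moreover have "R * cos (y - x0) = (R * cos x0) * cos y + (R * sin x0) * sin y"
      by (simp add: cos_diff algebra_simps)
    then have "R * cos (y - x0) = q * cos y - m * sin y"
      unfolding R by simp
    ultimately show ?thesis by simp
  qed
  have left: "0 \<le> K z" if z: "0 \<le> z" "z \<le> x0" for z
  proof -
    have "K 0 \<le> K z"
    proof (rule DERIV_nonneg_imp_nondecreasing[OF z(1)])
      fix y assume y: "0 \<le> y" "y \<le> z"
      have "cos x0 \<le> cos (x0 - y)"
        using y z x0 by (intro cos_monotone_0_pi_le) auto
      then have "R * cos x0 \<le> R * cos (x0 - y)" using R(3) by simp
      moreover have "cos (x0 - y) = cos (y - x0)" by (metis cos_minus minus_diff_eq)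
      ultimately have "0 \<le> R * cos (y - x0) - 1" using R(1) q1 by simp
      then show "\<exists>d. (K has_real_derivative d) (at y) \<and> 0 \<le> d" using K' by blast
    qed
    then show ?thesis by (simp add: K_def)
  qed
  have "0 \<le> K x"
  proof (cases "x \<le> x0")
    case True
    then show ?thesis using left x(1) by simp
  next
    case False
    have "concave_on {max 0 x0..pi/2 - m} K"
    proof (rule f''_le0_imp_concave)
      show "(K has_real_derivative R * cos (y - x0) - 1) (at y)" for y by (rule K')
      show "((\<lambda>y. R * cos (y - x0) - 1) has_real_derivative - R * sin (y - x0)) (at y)" for y
        by (auto intro!: derivative_eq_intros)
      \<comment> \<open>The bounds on x0 and m keep y - x0 in [0, pi] for either sign of m.\<close>
      show "- R * sin (y - x0) \<le> 0" if "y \<in> {max 0 x0..pi/2 - m}" for y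
        using that x0 m R(3) by (cases "0 \<le> m") (auto intro!: mult_nonneg_nonneg sin_ge_zero)
    qed simp
    then show ?thesis
    proof (rule concave_on_nonneg)
      show "0 \<le> K (max 0 x0)"
        using left[of x0] by (auto simp: max_def K_def)
      show "0 \<le> K (pi/2 - m)"
        using q by (simp add: K_def sin_diff cos_diff algebra_simps)
    qed (use x False in auto)
  qed
  then show ?thesis by (simp add: K_def)
qed

section \<open>Nonnegativity of the orbit on a half period\<close>

lemma orbit_scaled:
  assumes "c * sin (2 * pi * \<alpha>) = m" "c * cos (2 * pi * \<alpha>) = q"
  shows "2 * pi * orbit \<theta> c \<alpha> (\<alpha> + s) =
    2 * pi * (tri \<theta> - tri (s - \<theta>)) - m * (1 - cos (2 * pi * s)) + q * sin (2 * pi * s)"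
proof -
  have "sin (2 * pi * (\<alpha> + s)) = sin (2 * pi * \<alpha>) * cos (2 * pi * s) + cos (2 * pi * \<alpha>) * sin (2 * pi * s)"
    by (simp add: distrib_left sin_add)
  moreover have "2 * pi * orbit \<theta> c \<alpha> (\<alpha> + s) =
      2 * pi * (tri \<theta> - tri (s - \<theta>)) + c * (sin (2 * pi * (\<alpha> + s)) - sin (2 * pi * \<alpha>))"
    by (simp add: orbit_def field_simps)
  ultimately show ?thesis
    unfolding assms[symmetric] by (simp add: algebra_simps)
qed

text \<open>The branch after s = \<theta> is the branch before it under s -> 1/2 - s with m replaced
  by -m, so the inequality is needed for both signs. By monotonicity in m it is enough to have it
  for \<bar>\<open>u \<theta>\<close>\<bar>.\<close>

lemma orbit_nonneg_low:
  assumes "0 \<le> \<theta>" "\<theta> \<le> 1/2" "(\<theta>, c) \<in> region"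
  shows "(u \<theta>)\<^sup>2 \<le> c\<^sup>2" "0 < c"
    and "\<lbrakk>c * sin (2 * pi * \<alpha>) = u \<theta>; c * cos (2 * pi * \<alpha>) = sqrt (c\<^sup>2 - (u \<theta>)\<^sup>2); 0 \<le> s; s \<le> 1/2\<rbrakk>
      \<Longrightarrow> 0 \<le> orbit \<theta> c \<alpha> (\<alpha> + s)"
proof -
  note reg = assms(3)[unfolded region_def, simplified]
  define q where "q = sqrt (c\<^sup>2 - (u \<theta>)\<^sup>2)"
  have u_flip: "u (1/2 - \<theta>) = - u \<theta>" for \<theta>
    by (simp add: u_def algebra_simps)
  have main: "(u \<theta>)\<^sup>2 \<le> c\<^sup>2 \<and> (\<forall>x. 0 \<le> x \<longrightarrow> x \<le> pi \<longrightarrow> 0 \<le> excess \<bar>u \<theta>\<bar> q x)"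
  proof -
    consider "\<theta> = 0 \<or> \<theta> = 1/2" | "1/4 \<le> \<theta>" "\<theta> < 1/2" | "0 < \<theta>" "\<theta> < 1/4"
      using assms by linarith
    then show ?thesis
    proof cases
      case 1
      then have "\<bar>u \<theta>\<bar> = pi/2" by (elim disjE) (simp_all add: u_def)
      moreover from this have "(u \<theta>)\<^sup>2 = (pi/2)\<^sup>2" by (metis power2_abs)
      moreover have "(pi/2)\<^sup>2 + 1 \<le> c\<^sup>2" using reg 1 by (auto simp: power_divide)
      ultimately show ?thesis
        by (auto simp: q_def intro!: excess_nonneg_of_ge_1)
    next
      case 2
      then have "0 \<le> u \<theta>" by (simp add: u_def)
      moreover have "(u \<theta>)\<^sup>2 \<le> c\<^sup>2"
        using excess_nonneg_upper(1)[of \<theta> c] 2 reg by auto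
      moreover have "0 \<le> excess (u \<theta>) q x" if "0 \<le> x" "x \<le> pi" for x
        using excess_nonneg_upper(2)[of \<theta> c x] 2 reg that unfolding q_def by auto
      ultimately show ?thesis by auto
    next
      case 3
      \<comment> \<open>The reflection \<theta> -> 1/2 - \<theta> only flips the sign of
        \<open>u\<close>, which reduces this case to the previous range.\<close>
      define \<theta>' where "\<theta>' = 1/2 - \<theta>"
      have \<theta>': "1/4 \<le> \<theta>'" "\<theta>' < 1/2" "u \<theta>' = - u \<theta>" "\<bar>u \<theta>\<bar> = u \<theta>'"
        using 3 u_flip[of \<theta>] by (auto simp: \<theta>'_def u_def abs_mult)
      have "(u \<theta>')\<^sup>2 \<le> c\<^sup>2"
        using excess_nonneg_upper(1)[of \<theta>' c] \<theta>'(1,2) reg 3 unfolding \<theta>'_def by auto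
      moreover have "0 \<le> excess (u \<theta>') (sqrt (c\<^sup>2 - (u \<theta>')\<^sup>2)) x" if "0 \<le> x" "x \<le> pi" for x
        using excess_nonneg_upper(2)[of \<theta>' c x] \<theta>'(1,2) reg 3 that unfolding \<theta>'_def by auto
      ultimately show ?thesis unfolding \<theta>'(4) q_def using \<theta>'(3) by simp
    qed
  qed
  then show le: "(u \<theta>)\<^sup>2 \<le> c\<^sup>2" by blast
  \<comment> \<open>For c = 0 the bound forces \<open>u \<theta>\<close> = 0, hence \<theta> = 1/4,
    where the region demands c^2 > 0.\<close>
  have "c \<noteq> 0"
  proof
    assume "c = 0"
    then have "u \<theta> = 0" using le by simp
    then have "\<theta> = 1/4" by (simp add: u_def)
    with \<open>c = 0\<close> reg show False by auto
  qed
  then show "0 < c" using reg by simp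
  assume \<alpha>: "c * sin (2 * pi * \<alpha>) = u \<theta>" "c * cos (2 * pi * \<alpha>) = sqrt (c\<^sup>2 - (u \<theta>)\<^sup>2)" and s: "0 \<le> s" "s \<le> 1/2"
  have pos: "0 \<le> excess m q x" if "m \<le> \<bar>u \<theta>\<bar>" "0 \<le> x" "x \<le> pi" for m x
    using main that by (intro excess_mono[of m "\<bar>u \<theta>\<bar>" q q]) auto
  have x: "0 \<le> 2 * pi * s" "2 * pi * s \<le> pi" using s mult_left_mono[of s "1/2" "2 * pi"] by auto
  have tri_\<theta>: "tri \<theta> = \<theta>" using tri_eq[of \<theta> 0] assms by simp
  note S = orbit_scaled[OF \<alpha>, of \<theta> s, folded q_def]
  have "0 \<le> 2 * pi * orbit \<theta> c \<alpha> (\<alpha> + s)"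
  proof (cases "s \<le> \<theta>")
    case True
    then have "tri (s - \<theta>) = \<theta> - s" using tri_eq[of "s - \<theta>" 0] assms s by simp
    then have "2 * pi * orbit \<theta> c \<alpha> (\<alpha> + s) = excess (u \<theta>) q (2 * pi * s)"
      unfolding S tri_\<theta> by (simp add: excess_def)
    then show ?thesis using pos x by simp
  next
    case False
    then have tri_s: "tri (s - \<theta>) = s - \<theta>" using tri_eq[of "s - \<theta>" 0] assms s by simp
    have "2 * pi * (\<theta> - (s - \<theta>)) = pi - 2 * pi * s + 2 * u \<theta>"
      by (simp add: u_def algebra_simps)
    from S[unfolded tri_\<theta> tri_s this] have "2 * pi * orbit \<theta> c \<alpha> (\<alpha> + s) = excess (- u \<theta>) q (pi - 2 * pi * s)"
      by (simp add: excess_def algebra_simps)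
    then show ?thesis using pos[of "- u \<theta>" "pi - 2 * pi * s"] x by simp
  qed
  then show "0 \<le> orbit \<theta> c \<alpha> (\<alpha> + s)"
    by (simp add: zero_le_mult_iff not_le[THEN iffD2, OF pi_gt_zero])
qed

text \<open>As sin (2 pi \<theta>) < 0, the quotient Q is negative; the region condition amounts to
  q \<ge> -Q, which is nonnegativity at the corner in the form of
  \<open>deficit_nonneg\<close>.\<close>

lemma orbit_nonneg_high:
  assumes "1/2 < \<theta>" "\<theta> < 1" "(\<theta>, c) \<in> region"
  shows "(v \<theta>)\<^sup>2 \<le> c\<^sup>2" "0 < c"
    and "\<lbrakk>c * sin (2 * pi * \<alpha>) = v \<theta>; c * cos (2 * pi * \<alpha>) = sqrt (c\<^sup>2 - (v \<theta>)\<^sup>2); 0 \<le> s; s \<le> 1/2\<rbrakk>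
      \<Longrightarrow> 0 \<le> orbit \<theta> c \<alpha> (\<alpha> + s)"
proof -
  define m where "m = v \<theta>"
  define q where "q = sqrt (c\<^sup>2 - m\<^sup>2)"
  define Q where "Q = (pi/2 + m * cos (2 * pi * \<theta>)) / sin (2 * pi * \<theta>)"
  have c: "m\<^sup>2 + Q\<^sup>2 \<le> c\<^sup>2" "0 \<le> c"
    using assms unfolding region_def m_def Q_def by auto
  have m: "\<bar>m\<bar> < pi/2"
  proof -
    have "\<bar>3/2 - 2 * \<theta>\<bar> < 1/2" using assms by linarith
    then have "pi * \<bar>3/2 - 2 * \<theta>\<bar> < pi * (1/2)" by (rule mult_strict_left_mono) simp
    then show ?thesis by (simp add: m_def v_def abs_mult)
  qed
  have \<theta>: "2 * pi * \<theta> = (pi/2 - m) + pi" by (simp add: m_def v_def algebra_simps)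
  have trig: "sin (2 * pi * \<theta>) = - cos m" "cos (2 * pi * \<theta>) = - sin m"
    unfolding \<theta> sin_periodic_pi cos_periodic_pi by (simp_all add: sin_diff cos_diff)
  have cos_m: "0 < cos m" using m by (intro cos_gt_zero_pi) auto
  have msin: "m * sin m < pi/2"
  proof -
    have "\<bar>m * sin m\<bar> \<le> \<bar>m\<bar> * 1"
      unfolding abs_mult by (intro mult_left_mono) auto
    then show ?thesis using m by linarith
  qed
  have Q: "- Q = (pi/2 - m * sin m) / cos m"
    unfolding Q_def trig by simp
  then have Q0: "0 < - Q" using msin cos_m by simp
  show "(v \<theta>)\<^sup>2 \<le> c\<^sup>2" unfolding m_def[symmetric]
    using c(1) zero_le_power2[of Q] by linarith
  have "0 < c\<^sup>2"
    using c(1) Q0 zero_le_power2[of m] zero_less_power2[of Q] by linarith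
  then show "0 < c" using c(2) by (simp add: zero_less_power2)
  have "- Q \<le> q"
    unfolding q_def using c(1) by (intro real_le_rsqrt) simp
  then have q: "pi/2 - m * sin m \<le> q * cos m"
    using cos_m by (simp add: Q field_simps)
  assume \<alpha>: "c * sin (2 * pi * \<alpha>) = v \<theta>" "c * cos (2 * pi * \<alpha>) = sqrt (c\<^sup>2 - (v \<theta>)\<^sup>2)" and s: "0 \<le> s" "s \<le> 1/2"
  define x where "x = 2 * pi * s"
  have x: "0 \<le> x" "x \<le> pi" using s mult_left_mono[of s "1/2" "2 * pi"] by (auto simp: x_def)
  have tri_\<theta>: "tri \<theta> = 1 - \<theta>" using tri_eq[of \<theta> 1] assms by simp
  note S = orbit_scaled[OF \<alpha>[folded m_def, folded q_def], of \<theta> s, folded x_def]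
  have "0 \<le> 2 * pi * orbit \<theta> c \<alpha> (\<alpha> + s)"
  proof (cases "s \<le> \<theta> - 1/2")
    case True
    then have "tri (s - \<theta>) = 1 + s - \<theta>" using tri_eq[of "s - \<theta>" "-1"] assms s by simp
    then have "2 * pi * orbit \<theta> c \<alpha> (\<alpha> + s) = q * sin x - m * (1 - cos x) - x"
      unfolding S tri_\<theta> by (simp add: x_def algebra_simps)
    moreover have "2 * pi * s \<le> 2 * pi * (\<theta> - 1/2)"
      using True by (intro mult_left_mono) auto
    then have "x \<le> pi/2 - m" using \<theta> by (simp add: x_def algebra_simps)
    ultimately show ?thesis using deficit_nonneg[OF m q x(1)] by simp
  next
    case False
    then have tri_s: "tri (s - \<theta>) = \<theta> - s" using tri_eq[of "s - \<theta>" 0] assms s by simp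
    have "2 * pi * (1 - \<theta> - (\<theta> - s)) = x - pi + 2 * m"
      using \<theta> by (simp add: x_def algebra_simps)
    \<comment> \<open>Past the corner, x -> pi - x and m -> -m restore the first branch; the corner
      condition is even in m and so survives.\<close>
    from S[unfolded tri_\<theta> tri_s this] have "2 * pi * orbit \<theta> c \<alpha> (\<alpha> + s)
        = q * sin (pi - x) - (- m) * (1 - cos (pi - x)) - (pi - x)"
      by (simp add: algebra_simps)
    moreover have "2 * pi * (\<theta> - 1/2) \<le> 2 * pi * s"
      using False by (intro mult_left_mono) auto
    then have "pi - x \<le> pi/2 - (- m)" using \<theta> by (simp add: x_def algebra_simps)
    ultimately show ?thesis
      using deficit_nonneg[of "- m" q "pi - x"] m q x by simp
  qed
  then show "0 \<le> orbit \<theta> c \<alpha> (\<alpha> + s)"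
    by (simp add: zero_le_mult_iff not_le[THEN iffD2, OF pi_gt_zero])
qed

lemma orbit_nonneg:
  assumes "0 \<le> \<theta>" "\<theta> < 1" "(\<theta>, c) \<in> region"
  shows "\<bar>phase_value \<theta>\<bar> \<le> c" "0 < c"
    and "\<lbrakk>c * sin (2 * pi * \<alpha>) = phase_value \<theta>; 0 \<le> cos (2 * pi * \<alpha>); 0 \<le> s; s \<le> 1/2\<rbrakk>
      \<Longrightarrow> 0 \<le> orbit \<theta> c \<alpha> (\<alpha> + s)"
proof -
  define m where "m = phase_value \<theta>"
  \<comment> \<open>At \<theta> = 1/2 the values of \<open>u\<close> and \<open>v\<close> agree
    (both pi/2), so this point may join the lower range although \<open>phase_value\<close> uses
    \<open>v\<close> there.\<close>
  have m: "if \<theta> \<le> 1/2 then m = u \<theta> else m = v \<theta>"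
    by (auto simp: m_def phase_value_def u_def v_def)
  have le: "m\<^sup>2 \<le> c\<^sup>2" and c: "0 < c"
    using orbit_nonneg_low(1,2)[of \<theta> c] orbit_nonneg_high(1,2)[of \<theta> c] assms m
    by (auto split: if_splits)
  show "0 < c" by fact
  show "\<bar>phase_value \<theta>\<bar> \<le> c"
    using le c abs_le_square_iff[of m c] by (simp add: m_def)
  assume \<alpha>: "c * sin (2 * pi * \<alpha>) = phase_value \<theta>" "0 \<le> cos (2 * pi * \<alpha>)" and s: "0 \<le> s" "s \<le> 1/2"
  \<comment> \<open>The sign of the cosine selects the nonnegative root q.\<close>
  have "c * cos (2 * pi * \<alpha>) = sqrt ((c * cos (2 * pi * \<alpha>))\<^sup>2)"
    using c \<alpha>(2) by simp
  also have "(c * cos (2 * pi * \<alpha>))\<^sup>2 = c\<^sup>2 - (c * sin (2 * pi * \<alpha>))\<^sup>2"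
    by (simp add: power_mult_distrib cos_squared_eq right_diff_distrib)
  finally have "c * cos (2 * pi * \<alpha>) = sqrt (c\<^sup>2 - m\<^sup>2)"
    by (simp add: \<alpha> m_def)
  then show "0 \<le> orbit \<theta> c \<alpha> (\<alpha> + s)"
    using orbit_nonneg_low(3)[of \<theta> c \<alpha> s] orbit_nonneg_high(3)[of \<theta> c \<alpha> s] assms m s \<alpha>(1)
    by (auto simp flip: m_def split: if_splits)
qed

subsection \<open>From nonnegativity to a periodic orbit\<close>

lemma orbit_solution_of_nonneg:
  fixes k :: nat
  assumes \<theta>: "0 \<le> \<theta>" "\<theta> < 1" and phase: "c * sin (2 * pi * \<alpha>) = phase_value \<theta>"
    and nonneg: "\<And>s. 0 \<le> s \<Longrightarrow> s \<le> 1/2 \<Longrightarrow> 0 \<le> orbit \<theta> c \<alpha> (\<alpha> + s)"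
  defines "h \<equiv> orbit \<theta> c \<alpha>"
  shows "periodic_orbit_11 c (real k + \<theta>) h" "symmetric_orbit h" "\<alpha> + of_int n \<in> upward_zeros h"
proof -
  have half: "h (t + 1/2) = - h t" for t
  proof -
    \<comment> \<open>In h (t + 1/2) + h t the constant left by the triangular wave and the one left
      by the sine are both \<open>phase_value \<theta>\<close> / pi; the phase equation is what
      makes them cancel.\<close>
    have "2 * tri \<theta> - 1/2 = phase_value \<theta> / pi"
      using \<theta> tri_eq[of \<theta> 0] tri_eq[of \<theta> 1]
      by (auto simp: phase_value_def u_def v_def)
    moreover have "c / (2 * pi) * (2 * sin (2 * pi * \<alpha>)) = phase_value \<theta> / pi"
      by (simp flip: phase)
    moreover have "sin (2 * pi * (t + 1/2)) = - sin (2 * pi * t)"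
      by (simp add: distrib_left)
    moreover have "tri (t + 1/2 - \<alpha> - \<theta>) = 1/2 - tri (t - \<alpha> - \<theta>)"
      using tri_add_half[of "t - \<alpha> - \<theta>"] by (simp add: algebra_simps)
    ultimately show ?thesis
      by (simp add: h_def orbit_def algebra_simps)
  qed
  then show "symmetric_orbit h" by (simp add: symmetric_orbit_def)
  have int: "h (t + of_int n) = h t" for t n
    by (simp add: h_def orbit_add_int)
  have zero: "h (\<alpha> + of_int n) = 0" for n
    unfolding int by (simp add: h_def orbit_def tri_minus)
  have pos: "0 \<le> h (\<alpha> + of_int n + s)" if "0 \<le> s" "s \<le> 1/2" for s n
    using nonneg[OF that] int[of "\<alpha> + s" n] by (simp add: h_def add_ac)
  have neg: "h (\<alpha> + of_int n + s) \<le> 0" if "1/2 \<le> s" "s \<le> 1" for s n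
    using pos[of "s - 1/2" n] that half[of "\<alpha> + of_int n + (s - 1/2)"]
    by (simp add: add.assoc)
  \<comment> \<open>Isolated zeros upgrade the weak signs of h on the half periods to strict signs
    near \<alpha> + n.\<close>
  have isolated: "\<exists>\<delta>>0. \<forall>t. t \<noteq> z \<longrightarrow> \<bar>t - z\<bar> < \<delta> \<longrightarrow> h t \<noteq> 0" for z
  proof -
    obtain d where d: "0 < d" "\<And>t. t \<in> {t \<in> {z - 1..z + 1}. h t = 0} \<Longrightarrow> t \<noteq> z \<Longrightarrow> d \<le> dist z t"
      using finite_set_avoid[of "{t \<in> {z - 1..z + 1}. h t = 0}" z] finite_orbit_zeros
      unfolding h_def by blast
    show ?thesis
      by (intro exI[of _ "min d 1"]) (use d in \<open>fastforce simp: dist_real_def abs_if split: if_splits\<close>)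
  qed
  have up: "\<alpha> + of_int n \<in> upward_zeros h" for n
  proof -
    obtain \<delta> where \<delta>: "0 < \<delta>" "\<And>t. t \<noteq> \<alpha> + of_int n \<Longrightarrow> \<bar>t - (\<alpha> + of_int n)\<bar> < \<delta> \<Longrightarrow> h t \<noteq> 0"
      using isolated by metis
    define \<epsilon> where "\<epsilon> = min \<delta> (1/2)"
    have \<epsilon>: "0 < \<epsilon>" "\<epsilon> \<le> \<delta>" "\<epsilon> \<le> 1/2"
      using \<delta>(1) by (auto simp: \<epsilon>_def)
    have signs: "h zm < 0 \<and> 0 < h zp"
      if "zm \<in> {\<alpha> + of_int n - \<epsilon><..<\<alpha> + of_int n}" "zp \<in> {\<alpha> + of_int n<..<\<alpha> + of_int n + \<epsilon>}" for zm zp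
    proof -
      \<comment> \<open>Points left of \<alpha> + n lie in the second half of the period with index
        n - 1.\<close>
      have "h zm \<le> 0"
        using neg[of "zm - \<alpha> - of_int (n - 1)" "n - 1"] that \<epsilon>(3) by auto
      moreover have "0 \<le> h zp"
        using pos[of "zp - \<alpha> - of_int n" n] that \<epsilon>(3) by auto
      moreover have "h zm \<noteq> 0" "h zp \<noteq> 0"
        using \<delta>(2)[of zm] \<delta>(2)[of zp] that \<epsilon>(2) by auto
      ultimately show ?thesis by simp
    qed
    with \<epsilon>(1) show ?thesis
      unfolding upward_zeros_def nondeg_zeros_def using zero mult_neg_pos by blast
  qed
  then show "\<alpha> + of_int n \<in> upward_zeros h" .
  have up_int: "\<exists>n. z = \<alpha> + of_int n" if z: "z \<in> upward_zeros h" for z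
  proof -
    obtain \<delta> where \<delta>: "0 < \<delta>"
      "\<And>zm zp. zm \<in> {z - \<delta><..<z} \<Longrightarrow> zp \<in> {z<..<z + \<delta>} \<Longrightarrow> h zm < 0 \<and> 0 < h zp"
      using z unfolding upward_zeros_def by blast
    define n where "n = \<lfloor>z - \<alpha>\<rfloor>"
    define y where "y = z - \<alpha> - of_int n"
    have y: "0 \<le> y" "y < 1" unfolding y_def n_def by linarith+
    have "y = 0"
    proof (rule ccontr)
      assume "y \<noteq> 0"
      \<comment> \<open>The step e keeps z - e in the half period where h \<ge> 0 if y \<le> 1/2,
        and z + e in the one where h \<le> 0 otherwise; either contradicts an upward
        crossing.\<close>
      define e where "e = min (\<delta> / 2) (if y \<le> 1/2 then y / 2 else (1 - y) / 2)"
      have e: "0 < e" "e < \<delta>" "y \<le> 1/2 \<Longrightarrow> e < y" "\<not> y \<le> 1/2 \<Longrightarrow> e < 1 - y"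
        using \<delta>(1) y \<open>y \<noteq> 0\<close> by (auto simp: e_def min_def)
      have "h (z - e) < 0" "0 < h (z + e)"
        using \<delta>(2)[of "z - e" "z + e"] e by auto
      moreover have "z - e = \<alpha> + of_int n + (y - e)" "z + e = \<alpha> + of_int n + (y + e)"
        by (simp_all add: y_def)
      ultimately show False
        using pos[of "y - e" n] neg[of "y + e" n] e y by (cases "y \<le> 1/2") auto
    qed
    then have "z = \<alpha> + of_int n" unfolding y_def by linarith
    then show ?thesis ..
  qed
  have "prime_period h 1"
    unfolding prime_period_def is_period_def
  proof (intro conjI allI impI)
    show "h (t + 1) = h t" for t using int[of t 1] by simp
  next
    fix S :: real
    assume S: "0 < S \<and> (\<forall>t. h (t + S) = h t)"
    \<comment> \<open>A period carries upward zeros to upward zeros, so S is a positive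
      integer.\<close>
    have "\<alpha> + S \<in> upward_zeros h"
    proof -
      obtain \<delta> where \<delta>: "0 < \<delta>"
        "\<And>zm zp. zm \<in> {\<alpha> - \<delta><..<\<alpha>} \<Longrightarrow> zp \<in> {\<alpha><..<\<alpha> + \<delta>} \<Longrightarrow> h zm < 0 \<and> 0 < h zp"
        using up[of 0] unfolding upward_zeros_def by auto
      have "h zm < 0 \<and> 0 < h zp" if "zm \<in> {\<alpha> + S - \<delta><..<\<alpha> + S}" "zp \<in> {\<alpha> + S<..<\<alpha> + S + \<delta>}" for zm zp
        using \<delta>(2)[of "zm - S" "zp - S"] S[THEN conjunct2, rule_format, of "zm - S"]
          S[THEN conjunct2, rule_format, of "zp - S"] that by auto
      moreover have "h (\<alpha> + S) = 0" using S zero[of 0] by simp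
      ultimately show ?thesis
        unfolding upward_zeros_def nondeg_zeros_def using \<delta>(1) mult_neg_pos by blast
    qed
    then obtain n where "S = of_int n" using up_int by force
    then show "1 \<le> S" using S by simp
  qed simp
  moreover have "finite {t \<in> {a..<a + 1}. h t = 0}" for a
    by (rule finite_subset[OF _ finite_orbit_zeros[of a "a + 1" \<theta> c \<alpha>]]) (auto simp: h_def)
  moreover have "\<exists>!z. z \<in> {a..<a + 1} \<and> z \<in> upward_zeros h" for a
  proof (rule ex1I)
    show "\<alpha> + of_int \<lceil>a - \<alpha>\<rceil> \<in> {a..<a + 1} \<and> \<alpha> + of_int \<lceil>a - \<alpha>\<rceil> \<in> upward_zeros h"
      using up by simp linarith
    fix z assume z: "z \<in> {a..<a + 1} \<and> z \<in> upward_zeros h"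
    then obtain n where n: "z = \<alpha> + of_int n" using up_int by blast
    then have "n = \<lceil>a - \<alpha>\<rceil>" using z by (intro ceiling_unique[symmetric]) auto
    then show "z = \<alpha> + of_int \<lceil>a - \<alpha>\<rceil>" using n by simp
  qed
  moreover have "is_solution c (real k + \<theta>) h"
    unfolding is_solution_def
  proof
    show "locally_abs_continuous h"
      unfolding h_def by (rule lipschitz_imp_locally_abs_continuous[OF orbit_lipschitz])
    \<comment> \<open>The exceptional set consists of the zeros of the delayed orbit, which are
      countable because finite on bounded intervals.\<close>
    define Z where "Z = {t. h (t - (real k + \<theta>)) = 0}"
    have "{t. h t = 0} = (\<Union>n. {t \<in> {- real n..real n}. h t = 0})"
    proof -
      have "\<exists>n. - real n \<le> t \<and> t \<le> real n" for t
      proof -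
        obtain n where "\<bar>t\<bar> \<le> real n" using real_arch_simple by blast
        then show ?thesis by (intro exI[of _ n]) linarith
      qed
      then show ?thesis by auto
    qed
    then have "countable {t. h t = 0}"
      by (simp add: h_def countable_UN countable_finite finite_orbit_zeros del: atLeastAtMost_iff)
    then have "countable ((\<lambda>t. t + (real k + \<theta>)) ` {t. h t = 0})" by (rule countable_image)
    moreover have "Z \<subseteq> (\<lambda>t. t + (real k + \<theta>)) ` {t. h t = 0}"
      unfolding Z_def by (auto intro!: image_eqI[where x = "_ - (real k + \<theta>)"])
    ultimately have "countable Z" by (rule countable_subset[rotated])
    then have "Z \<in> null_sets lebesgue"
      by (intro null_sets_completionI countable_imp_null_set_lborel)
    moreover have "(h has_real_derivative (- sgn (h (t - (real k + \<theta>))) + c * cos (2 * pi * t))) (at t)"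
      if "t \<notin> Z" for t
    proof -
      define x where "x = t - \<alpha> - \<theta>"
      define n where "n = \<lfloor>x\<rfloor>"
      define y where "y = x - of_int n"
      have y: "0 \<le> y" "y < 1" unfolding y_def n_def by linarith+
      \<comment> \<open>The integer part k of the delay only shifts the period index.\<close>
      define j where "j = n - int k"
      have t: "t - (real k + \<theta>) = \<alpha> + of_int j + y"
        by (simp add: j_def x_def y_def)
      have nz: "h (\<alpha> + of_int j + y) \<noteq> 0"
        using that unfolding Z_def t[symmetric] by simp
      have "h (\<alpha> + of_int j + 1/2) = 0" using half zero by simp
      \<comment> \<open>The corners of the triangular wave occur exactly where the delayed argument
        meets \<alpha> + j or \<alpha> + j + 1/2; these are zeros of h and so already lie in
        Z.\<close>
      then have y2: "y \<noteq> 0" "y \<noteq> 1/2" using nz zero[of j] by (metis add.right_neutral, metis)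
      \<comment> \<open>The slope of the wave is 1 on the half period where the delayed orbit is
        positive and -1 on the other.\<close>
      have "(tri has_real_derivative sgn (h (t - (real k + \<theta>)))) (at x)"
      proof (cases "y < 1/2")
        case True
        then have "sgn (h (t - (real k + \<theta>))) = 1"
          unfolding t using pos[of y j] nz y by simp
        then show ?thesis
          using tri_has_derivative_up[of n x] True y y2 by (simp add: y_def)
      next
        case False
        then have "sgn (h (t - (real k + \<theta>))) = -1"
          unfolding t using neg[of y j] nz y by simp
        then show ?thesis
          using tri_has_derivative_down[of "n + 1" x] False y y2 by (simp add: y_def)
      qed
      then have "((\<lambda>t. tri (t - \<alpha> - \<theta>)) has_real_derivative sgn (h (t - (real k + \<theta>))) * 1) (at t)"
        unfolding x_def by (rule DERIV_chain2) (auto intro!: derivative_eq_intros)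
      then show ?thesis
        unfolding h_def orbit_def[abs_def] by (auto intro!: derivative_eq_intros)
    qed
    ultimately show "AE t in lebesgue. (h has_real_derivative
        (- sgn (h (t - (real k + \<theta>))) + c * cos (2 * pi * t))) (at t)"
      by (intro AE_I'[of Z]) auto
  qed
  ultimately show "periodic_orbit_11 c (real k + \<theta>) h"
    by (simp add: periodic_orbit_11_def)
qed

section \<open>The phase and the final assembly\<close>

lemma abs_angle_le:
  assumes "\<alpha> \<in> {-1/4..1/4 :: real}"
  shows "\<bar>2 * pi * \<alpha>\<bar> \<le> pi/2"
proof -
  have "2 * pi * \<bar>\<alpha>\<bar> \<le> 2 * pi * (1/4)"
    using assms by (intro mult_left_mono) auto
  then show ?thesis by (simp add: abs_mult)
qed

lemma phase_unique:
  assumes "0 < c" "\<bar>m\<bar> \<le> c"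
  shows "\<exists>!\<alpha>. \<alpha> \<in> {-1/4..1/4} \<and> c * sin (2 * pi * \<alpha>) = m"
proof (rule ex1I)
  have mc: "-1 \<le> m / c" "m / c \<le> 1" using assms by (auto simp: field_simps)
  have "- (pi/2) \<le> arcsin (m / c)" "arcsin (m / c) \<le> pi/2"
    using arcsin_bounded[OF mc] by auto
  then show "arcsin (m / c) / (2 * pi) \<in> {-1/4..1/4} \<and> c * sin (2 * pi * (arcsin (m / c) / (2 * pi))) = m"
    using mc assms by (simp add: field_simps)
  fix \<alpha> assume \<alpha>: "\<alpha> \<in> {-1/4..1/4} \<and> c * sin (2 * pi * \<alpha>) = m"
  have "arcsin (sin (2 * pi * \<alpha>)) = 2 * pi * \<alpha>"
    using abs_angle_le[of \<alpha>] \<alpha> by (intro arcsin_sin) auto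
  moreover have "sin (2 * pi * \<alpha>) = m / c" using \<alpha> assms by (auto simp: field_simps)
  ultimately show "\<alpha> = arcsin (m / c) / (2 * pi)" by simp
qed

theorem theorem3p8:
  fixes k :: nat and \<theta> c \<tau> :: real
  assumes "0 \<le> \<theta>" and "\<theta> < 1"
    and "\<tau> = real k + \<theta>"
    and "(\<theta>, c) \<in> region"
  shows "\<exists>h :: real \<Rightarrow> real.
      periodic_orbit_11 c \<tau> h \<and> symmetric_orbit h \<and>
      (\<exists>!\<alpha>. \<alpha> \<in> {-1/4..1/4} \<and> c * sin (2 * pi * \<alpha>) = phase_value \<theta>) \<and>
      (\<forall>\<alpha>. (\<exists>m::int. \<alpha> + of_int m \<in> {-1/4..1/4}) \<and> c * sin (2 * pi * \<alpha>) = phase_value \<theta> \<longrightarrow>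
         \<alpha> \<in> upward_zeros h \<and>
         (\<forall>t. h t = p \<theta> \<alpha> t + c / (2 * pi) * (sin (2 * pi * t) - sin (2 * pi * \<alpha>))))"
proof -
  note R = orbit_nonneg[OF assms(1,2,4)]
  note uniq = phase_unique[OF R(2,1)]
  then obtain \<alpha> where \<alpha>: "\<alpha> \<in> {-1/4..1/4}" "c * sin (2 * pi * \<alpha>) = phase_value \<theta>" by blast
  have "0 \<le> cos (2 * pi * \<alpha>)"
    using abs_angle_le[OF \<alpha>(1)] unfolding abs_le_iff by (intro cos_ge_zero) linarith+
  note sol = orbit_solution_of_nonneg[OF assms(1,2) \<alpha>(2) R(3)[OF \<alpha>(2) this], simplified]
  have "\<beta> \<in> upward_zeros (orbit \<theta> c \<alpha>) \<and>
      (\<forall>t. orbit \<theta> c \<alpha> t = p \<theta> \<beta> t + c / (2 * pi) * (sin (2 * pi * t) - sin (2 * pi * \<beta>)))"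
    if \<beta>: "\<beta> + of_int m \<in> {-1/4..1/4}" "c * sin (2 * pi * \<beta>) = phase_value \<theta>" for \<beta> and m :: int
  proof -
    \<comment> \<open>Shifting \<beta> into [-1/4, 1/4] keeps its phase equation, so uniqueness
      identifies it with the chosen \<alpha>.\<close>
    have "\<beta> + of_int m = \<alpha>"
      using uniq \<alpha> \<beta> by (metis sin_2pi_add_int)
    then have \<beta>_eq: "\<beta> = \<alpha> + of_int (- m)" by simp
    have "orbit \<theta> c \<alpha> t = orbit \<theta> c \<beta> t" for t
      unfolding \<beta>_eq by (rule orbit_phase_add_int[symmetric])
    moreover have "\<beta> \<in> upward_zeros (orbit \<theta> c \<alpha>)"
      unfolding \<beta>_eq by (rule sol(3))
    ultimately show ?thesis
      using assms(1,2) by (simp add: orbit_def p_eq_tri)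
  qed
  then show ?thesis
    unfolding assms(3) using sol(1,2) uniq by blast
qed

end
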